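(* Let $C$ be a unital real composition algebra of dimension $d$ whose quadratic form has signature $(p,q)$. Then $$\mathrm{SL}_2(C)\cong \mathrm{Spin}(p+1,q+1).$$
   Context: A composition algebra is a not necessarily unital or associative algebra $C$ over a field, together with a nondegenerate quadratic form $|\cdot|^2$ that is multiplicative: $|zw|^2=|z|^2|w|^2$. It is real if the field is $\mathbb{R}$. The signature $(p,q)$ means that $|\cdot|^2$ has $p$ positive and $q$ negative directions, $p+q=d$. For a (not necessarily associative) ring $R$, $M_m(R)$ is the set of $m\times m$ matrices over $R$, and $aE_{ij}$ is the matrix with $a$ in position $(i,j)$ and zeros elsewhere. For a matrix $x$, $L_x$ is the left multiplication map $v\mapsto xv$ on column vectors $R^m$ (equivalently on $M_m(R)$). Definition: $\mathrm{SL}_m(R)$ is the group generated by $\{L_{I+aE_{ij}} : a\in R,\ i\neq j\}$ under composition, where $I$ is the identity matrix. For $C$ a unital real composition algebra of dimension $d$ whose quadratic form has signature $(p,q)$, $\mathrm{SL}_2(C)$ is a connected Lie group of real linear maps of $C^2$. $\mathrm{Spin}(p+1,q+1)$ denotes the (connected) spin group, i.e. the identity component of the spin group of the standard quadratic form of signature $(p+1,q+1)$ on $\mathbb{R}^{p+q+2}$; it is a double cover of the identity component $\mathrm{SO}_0(p+1,q+1)$ of $\mathrm{SO}(p+1,q+1)$. The isomorphism is one of Lie groups. *)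

theory Defs
  imports
    "HOL-Analysis.Analysis"
    "HOL-Algebra.Bij"
    "HOL-Algebra.Generated_Groups"
begin

section \<open>Unital real composition algebras\<close>

definition polar :: "('a::real_vector \<Rightarrow> real) \<Rightarrow> 'a \<Rightarrow> 'a \<Rightarrow> real" where
  "polar Q x y = Q (x + y) - Q x - Q y"

definition quadratic_form :: "('a::real_vector \<Rightarrow> real) \<Rightarrow> bool" where
  "quadratic_form Q \<longleftrightarrow> (\<forall>r x. Q (r *\<^sub>R x) = r\<^sup>2 * Q x) \<and> bilinear (polar Q)"

definition nondegenerate :: "('a::real_vector \<Rightarrow> real) \<Rightarrow> bool" where
  "nondegenerate Q \<longleftrightarrow> (\<forall>x. (\<forall>y. polar Q x y = 0) \<longrightarrow> x = 0)"

definition has_signature :: "('a::real_vector \<Rightarrow> real) \<Rightarrow> nat \<Rightarrow> nat \<Rightarrow> bool" where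
  "has_signature Q p q \<longleftrightarrow>
     (\<exists>B. finite B \<and> independent B \<and> span B = UNIV \<and>
          (\<forall>x\<in>B. \<forall>y\<in>B. x \<noteq> y \<longrightarrow> polar Q x y = 0) \<and>
          card {x \<in> B. Q x > 0} = p \<and> card {x \<in> B. Q x < 0} = q)"

text \<open>
  The underlying vector space is a type of class \<open>euclidean_space\<close>, i.e. an arbitrary nonzero
  finite-dimensional real vector space.  The inner product of that class plays no role besides
  providing the usual topology; it is unrelated to the form \<open>Q\<close>.
\<close>

definition unital_real_composition_algebra ::
  "('a::euclidean_space \<Rightarrow> 'a \<Rightarrow> 'a) \<Rightarrow> 'a \<Rightarrow> ('a \<Rightarrow> real) \<Rightarrow> bool" where
  "unital_real_composition_algebra cmul e Q \<longleftrightarrow>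
     bilinear cmul \<and> (\<forall>x. cmul e x = x \<and> cmul x e = x) \<and>
     quadratic_form Q \<and> nondegenerate Q \<and> (\<forall>z w. Q (cmul z w) = Q z * Q w)"


section \<open>The group \<open>SL\<^sub>m(R)\<close> over a not necessarily associative ring\<close>

text \<open>\<open>R\<close> is given by its additive group (a type), its product \<open>cmul\<close> and its unit \<open>e\<close>.\<close>

definition left_mult_map ::
  "('a::ab_group_add \<Rightarrow> 'a \<Rightarrow> 'a) \<Rightarrow> 'a ^ 'm ^ 'm \<Rightarrow> 'a ^ 'm \<Rightarrow> 'a ^ 'm" where
  "left_mult_map cmul x v = (\<chi> i. \<Sum>j\<in>UNIV. cmul (x $ i $ j) (v $ j))"

definition identity_matrix :: "'a::ab_group_add \<Rightarrow> 'a ^ 'm ^ 'm" where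
  "identity_matrix e = (\<chi> i j. if i = j then e else 0)"

definition unit_matrix :: "'a::ab_group_add \<Rightarrow> 'm \<Rightarrow> 'm \<Rightarrow> 'a ^ 'm ^ 'm" where
  "unit_matrix a i j = (\<chi> k l. if k = i \<and> l = j then a else 0)"

definition SL :: "('a::ab_group_add \<Rightarrow> 'a \<Rightarrow> 'a) \<Rightarrow> 'a \<Rightarrow> ('a ^ 'm \<Rightarrow> 'a ^ 'm) monoid" where
  "SL cmul e = (BijGroup UNIV)
     \<lparr>carrier := generate (BijGroup UNIV)
        {left_mult_map cmul (identity_matrix e + unit_matrix a i j) | a i j. i \<noteq> j}\<rparr>"


section \<open>Lie group isomorphisms\<close>

text \<open>
  Linear Lie groups are groups whose carrier is a subset of a finite-dimensional real normed
  space.  Smoothness on such a subset means having local smooth extensions to open subsets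
  of the ambient space.
\<close>

primrec Ck_on :: "nat \<Rightarrow> ('a::real_normed_vector \<Rightarrow> 'b::real_normed_vector) \<Rightarrow> 'a set \<Rightarrow> bool" where
  "Ck_on 0 f U \<longleftrightarrow> continuous_on U f"
| "Ck_on (Suc k) f U \<longleftrightarrow>
     (\<forall>x\<in>U. f differentiable (at x)) \<and> (\<forall>v. Ck_on k (\<lambda>x. frechet_derivative f (at x) v) U)"

definition smooth_map_on ::
  "'a::real_normed_vector set \<Rightarrow> ('a \<Rightarrow> 'b::real_normed_vector) \<Rightarrow> bool" where
  "smooth_map_on S f \<longleftrightarrow>
     (\<forall>x\<in>S. \<exists>U g. open U \<and> x \<in> U \<and> (\<forall>k. Ck_on k g U) \<and> (\<forall>y\<in>S \<inter> U. g y = f y))"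

definition lie_group_isomorphic ::
  "'a::real_normed_vector monoid \<Rightarrow> 'b::real_normed_vector monoid \<Rightarrow> bool" where
  "lie_group_isomorphic G H \<longleftrightarrow>
     (\<exists>f \<in> iso G H. smooth_map_on (carrier G) f \<and>
                    smooth_map_on (carrier H) (inv_into (carrier G) f))"

text \<open>A group of linear maps, placed in the normed space of all (bounded) linear maps:\<close>

definition linear_group :: "('a::real_normed_vector \<Rightarrow> 'a) monoid \<Rightarrow> ('a \<Rightarrow>\<^sub>L 'a) monoid" where
  "linear_group G = \<lparr>carrier = Blinfun ` carrier G, mult = (o\<^sub>L), one = id_blinfun\<rparr>"


section \<open>Clifford algebras and spin groups\<close>

text \<open>
  The standard form of signature \<open>(p, q)\<close> lives on \<open>real ^ 'n\<close> with \<open>CARD('n) = p + q\<close>: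
  it is positive on the first \<open>p\<close> coordinates and negative on the remaining \<open>q\<close> ones.
\<close>

definition standard_sign :: "nat \<Rightarrow> nat \<Rightarrow> 'n::{finite,linorder} \<Rightarrow> real" where
  "standard_sign p q i =
     (if card {j. j < i} < p then 1 else if card {j. j < i} < p + q then -1 else 0)"

definition diagonal_form :: "('n::finite \<Rightarrow> real) \<Rightarrow> real ^ 'n \<Rightarrow> real" where
  "diagonal_form \<epsilon> v = (\<Sum>i\<in>UNIV. \<epsilon> i * (v $ i)\<^sup>2)"

text \<open>
  The Clifford algebra of \<open>diagonal_form \<epsilon>\<close>, with the convention \<open>v\<^sup>2 = Q(v)\<close>, has the basis
  \<open>e\<^sub>A = e\<^sub>i\<^sub>1 \<cdots> e\<^sub>i\<^sub>k\<close> for \<open>A = {i\<^sub>1 < \<dots> < i\<^sub>k}\<close>, so its underlying space is \<open>real ^ ('n set)\<close>.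
  The products \<open>e\<^sub>A e\<^sub>B\<close> follow from \<open>e\<^sub>i e\<^sub>j = - e\<^sub>j e\<^sub>i\<close> and \<open>e\<^sub>i\<^sup>2 = \<epsilon> i\<close>.
\<close>

definition clifford_sign :: "('n::{finite,linorder} \<Rightarrow> real) \<Rightarrow> 'n set \<Rightarrow> 'n set \<Rightarrow> real" where
  "clifford_sign \<epsilon> A B = (-1) ^ card {(a, b). a \<in> A \<and> b \<in> B \<and> b < a} * (\<Prod>i\<in>A \<inter> B. \<epsilon> i)"

definition clifford_mult :: "('n::{finite,linorder} \<Rightarrow> real) \<Rightarrow>
    real ^ ('n set) \<Rightarrow> real ^ ('n set) \<Rightarrow> real ^ ('n set)" where
  "clifford_mult \<epsilon> x y =
     (\<Sum>A\<in>UNIV. \<Sum>B\<in>UNIV. axis (sym_diff A B) (clifford_sign \<epsilon> A B * (x $ A) * (y $ B)))"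

definition clifford_one :: "real ^ ('n::finite set)" where
  "clifford_one = axis {} 1"

definition clifford_vec :: "real ^ 'n \<Rightarrow> real ^ ('n::finite set)" where
  "clifford_vec v = (\<Sum>i\<in>UNIV. axis {i} (v $ i))"

definition Spin_full :: "('n::{finite,linorder} \<Rightarrow> real) \<Rightarrow> (real ^ ('n set)) set" where
  "Spin_full \<epsilon> =
     {foldr (clifford_mult \<epsilon>) (map clifford_vec vs) clifford_one | vs.
        even (length vs) \<and> (\<forall>v\<in>set vs. \<bar>diagonal_form \<epsilon> v\<bar> = 1)}"

text \<open>\<open>Spin p q\<close> is the identity component of the full spin group of signature \<open>(p, q)\<close>.\<close>

definition Spin :: "nat \<Rightarrow> nat \<Rightarrow> (real ^ ('n::{finite,linorder} set)) monoid" where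
  "Spin p q =
     \<lparr>carrier = connected_component_set (Spin_full (standard_sign p q)) clifford_one,
      mult = clifford_mult (standard_sign p q), one = clifford_one\<rparr>"

text \<open>The defining properties of the Clifford algebra.\<close>

lemma clifford_sign_alt:
  "clifford_sign \<epsilon> A B =
     (\<Prod>a\<in>A. \<Prod>b\<in>B. if b < a then -1 else 1) * (\<Prod>i\<in>A \<inter> B. \<epsilon> i)"
proof -
  have "(\<Prod>a\<in>A. \<Prod>b\<in>B. if b < a then -1 else (1::real)) =
        (\<Prod>(a, b)\<in>A \<times> B. if b < a then -1 else 1)"
    by (rule prod.cartesian_product)
  also have "\<dots> = (\<Prod>z\<in>{(a, b). a \<in> A \<and> b \<in> B \<and> b < a}. -1)"
    by (rule prod.mono_neutral_cong_right) (auto split: if_splits)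
  also have "\<dots> = (-1) ^ card {(a, b). a \<in> A \<and> b \<in> B \<and> b < a}"
    by simp
  finally show ?thesis
    by (simp add: clifford_sign_def)
qed

lemma prod_sym_diff:
  fixes h :: "'n::finite \<Rightarrow> real"
  assumes "\<And>i. h i * h i = 1"
  shows "prod h (sym_diff A B) = prod h A * prod h B"
proof -
  have A: "prod h A = prod h (A - B) * prod h (A \<inter> B)"
    by (subst prod.union_disjoint [symmetric]) (auto intro: prod.cong)
  have B: "prod h B = prod h (B - A) * prod h (A \<inter> B)"
    by (subst prod.union_disjoint [symmetric]) (auto intro: prod.cong)
  have "prod h (sym_diff A B) = prod h (A - B) * prod h (B - A)"
    by (rule prod.union_disjoint) auto
  moreover have "prod h (A \<inter> B) * prod h (A \<inter> B) = 1"
    by (simp add: prod.distrib [symmetric] assms)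
  ultimately show ?thesis
    by (simp add: A B algebra_simps)
qed

lemma clifford_sign_cocycle:
  "clifford_sign \<epsilon> A B * clifford_sign \<epsilon> (sym_diff A B) C =
   clifford_sign \<epsilon> B C * clifford_sign \<epsilon> A (sym_diff B C)"
proof -
  define g where "g a b = (if b < a then -1 else (1::real))" for a b :: 'a
  define G where "G A B = (\<Prod>a\<in>A. \<Prod>b\<in>B. g a b)" for A B
  have g: "g a b * g a b = 1" for a b
    by (simp add: g_def)
  have 1: "G (sym_diff A B) C = G A C * G B C"
    unfolding G_def by (rule prod_sym_diff) (simp add: prod.distrib [symmetric] g)
  have 2: "G A (sym_diff B C) = G A B * G A C"
    unfolding G_def by (simp add: prod_sym_diff g prod.distrib)
  have 3: "prod \<epsilon> (A \<inter> B) * prod \<epsilon> (sym_diff A B \<inter> C) =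
           prod \<epsilon> (B \<inter> C) * prod \<epsilon> (A \<inter> sym_diff B C)"
  proof -
    have "prod \<epsilon> (A \<inter> B) * prod \<epsilon> (sym_diff A B \<inter> C) = prod \<epsilon> (A \<inter> B \<union> sym_diff A B \<inter> C)"
      by (rule prod.union_disjoint [symmetric]) auto
    also have "A \<inter> B \<union> sym_diff A B \<inter> C = B \<inter> C \<union> A \<inter> sym_diff B C"
      by auto
    also have "prod \<epsilon> \<dots> = prod \<epsilon> (B \<inter> C) * prod \<epsilon> (A \<inter> sym_diff B C)"
      by (rule prod.union_disjoint) auto
    finally show ?thesis .
  qed
  have s: "clifford_sign \<epsilon> A B = G A B * prod \<epsilon> (A \<inter> B)" for A B
    by (simp add: clifford_sign_alt G_def g_def)
  have "clifford_sign \<epsilon> A B * clifford_sign \<epsilon> (sym_diff A B) C =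
        (G A B * G A C * G B C) * (prod \<epsilon> (A \<inter> B) * prod \<epsilon> (sym_diff A B \<inter> C))"
    unfolding s 1 by (simp only: mult_ac)
  also have "\<dots> = clifford_sign \<epsilon> B C * clifford_sign \<epsilon> A (sym_diff B C)"
    unfolding s 2 3 by (simp only: mult_ac)
  finally show ?thesis .
qed

lemma clifford_mult_nth:
  "clifford_mult \<epsilon> x y $ C =
     (\<Sum>A\<in>UNIV. clifford_sign \<epsilon> A (sym_diff A C) * x $ A * y $ (sym_diff A C))"
proof -
  have "(\<Sum>B\<in>UNIV. axis (sym_diff A B) (clifford_sign \<epsilon> A B * x $ A * y $ B) $ C) =
        clifford_sign \<epsilon> A (sym_diff A C) * x $ A * y $ (sym_diff A C)" for A
  proof -
    have "(\<Sum>B\<in>UNIV. axis (sym_diff A B) (clifford_sign \<epsilon> A B * x $ A * y $ B) $ C) =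
          (\<Sum>B\<in>UNIV. if B = sym_diff A C then clifford_sign \<epsilon> A B * x $ A * y $ B else 0)"
      by (rule sum.cong) (auto simp: axis_def)
    then show ?thesis by simp
  qed
  then show ?thesis
    by (simp add: clifford_mult_def)
qed

lemma clifford_mult_assoc:
  "clifford_mult \<epsilon> (clifford_mult \<epsilon> x y) z = clifford_mult \<epsilon> x (clifford_mult \<epsilon> y z)"
proof (rule vec_eq_iff [THEN iffD2], rule allI)
  fix D
  have sd: "sym_diff A (sym_diff A B) = B" for A B :: "'a set" by auto
  have bij: "bij_betw (sym_diff A) UNIV UNIV" for A :: "'a set"
    by (rule bij_betwI [where g = "sym_diff A"]) (simp_all only: sd, auto)
  have asc: "sym_diff (sym_diff A B) D = sym_diff B (sym_diff A D)" for A B :: "'a set" by auto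
  have "clifford_mult \<epsilon> (clifford_mult \<epsilon> x y) z $ D =
    (\<Sum>E\<in>UNIV. \<Sum>A\<in>UNIV. clifford_sign \<epsilon> E (sym_diff E D) * clifford_sign \<epsilon> A (sym_diff A E) *
       x $ A * y $ (sym_diff A E) * z $ (sym_diff E D))"
    unfolding clifford_mult_nth by (simp add: sum_distrib_left sum_distrib_right mult_ac)
  also have "\<dots> = (\<Sum>A\<in>UNIV. \<Sum>E\<in>UNIV. clifford_sign \<epsilon> E (sym_diff E D) *
       clifford_sign \<epsilon> A (sym_diff A E) * x $ A * y $ (sym_diff A E) * z $ (sym_diff E D))"
    by (rule sum.swap)
  also have "\<dots> = (\<Sum>A\<in>UNIV. \<Sum>B\<in>UNIV. clifford_sign \<epsilon> (sym_diff A B) (sym_diff (sym_diff A B) D) *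
       clifford_sign \<epsilon> A B * x $ A * y $ B * z $ (sym_diff (sym_diff A B) D))"
  proof (rule sum.cong [OF refl])
    fix A :: "'a set"
    show "(\<Sum>E\<in>UNIV. clifford_sign \<epsilon> E (sym_diff E D) *
       clifford_sign \<epsilon> A (sym_diff A E) * x $ A * y $ (sym_diff A E) * z $ (sym_diff E D)) =
      (\<Sum>B\<in>UNIV. clifford_sign \<epsilon> (sym_diff A B) (sym_diff (sym_diff A B) D) *
       clifford_sign \<epsilon> A B * x $ A * y $ B * z $ (sym_diff (sym_diff A B) D))"
      by (subst sum.reindex_bij_betw [OF bij [of A], symmetric]) (simp only: sd)
  qed
  also have "\<dots> = (\<Sum>A\<in>UNIV. \<Sum>B\<in>UNIV. clifford_sign \<epsilon> A (sym_diff A D) *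
       clifford_sign \<epsilon> B (sym_diff B (sym_diff A D)) * x $ A * y $ B *
       z $ (sym_diff B (sym_diff A D)))"
  proof (intro sum.cong refl)
    fix A B :: "'a set"
    show "clifford_sign \<epsilon> (sym_diff A B) (sym_diff (sym_diff A B) D) *
       clifford_sign \<epsilon> A B * x $ A * y $ B * z $ (sym_diff (sym_diff A B) D) =
      clifford_sign \<epsilon> A (sym_diff A D) * clifford_sign \<epsilon> B (sym_diff B (sym_diff A D)) *
       x $ A * y $ B * z $ (sym_diff B (sym_diff A D))"
      using clifford_sign_cocycle [of \<epsilon> A B "sym_diff B (sym_diff A D)"]
      unfolding asc sd by (simp add: algebra_simps)
  qed
  also have "\<dots> = clifford_mult \<epsilon> x (clifford_mult \<epsilon> y z) $ D"
    unfolding clifford_mult_nth by (simp add: sum_distrib_left sum_distrib_right mult_ac)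
  finally show "clifford_mult \<epsilon> (clifford_mult \<epsilon> x y) z $ D =
    clifford_mult \<epsilon> x (clifford_mult \<epsilon> y z) $ D" .
qed

lemma bilinear_clifford_mult: "bilinear (clifford_mult \<epsilon>)"
  unfolding bilinear_def
  by (auto intro!: linearI simp: vec_eq_iff clifford_mult_nth algebra_simps sum.distrib
      sum_distrib_left)

lemma clifford_mult_axis:
  "clifford_mult \<epsilon> (axis A a) (axis B b) = axis (sym_diff A B) (clifford_sign \<epsilon> A B * a * b)"
proof (rule vec_eq_iff [THEN iffD2], rule allI)
  fix C
  have "clifford_mult \<epsilon> (axis A a) (axis B b) $ C =
        (\<Sum>A'\<in>UNIV. if A' = A then clifford_sign \<epsilon> A (sym_diff A C) * a * axis B b $ (sym_diff A C) else 0)"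
    unfolding clifford_mult_nth by (rule sum.cong) (auto simp: axis_def)
  also have "\<dots> = clifford_sign \<epsilon> A (sym_diff A C) * a * axis B b $ (sym_diff A C)"
    by simp
  also have "\<dots> = axis (sym_diff A B) (clifford_sign \<epsilon> A B * a * b) $ C"
  proof (cases "C = sym_diff A B")
    case True
    moreover from True have "sym_diff A C = B" by auto
    ultimately show ?thesis by (simp add: axis_def)
  next
    case False
    then have "sym_diff A C \<noteq> B" by auto
    with False show ?thesis by (simp add: axis_def)
  qed
  finally show "clifford_mult \<epsilon> (axis A a) (axis B b) $ C =
    axis (sym_diff A B) (clifford_sign \<epsilon> A B * a * b) $ C" .
qed

lemma clifford_mult_one:
  "clifford_mult \<epsilon> clifford_one x = x" "clifford_mult \<epsilon> x clifford_one = x"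
proof -
  have x: "x = (\<Sum>A\<in>UNIV. axis A (x $ A))"
    by (simp add: vec_eq_iff axis_def)
  have s: "clifford_sign \<epsilon> {} A = 1" "clifford_sign \<epsilon> A {} = 1" for A
    by (simp_all add: clifford_sign_def)
  show "clifford_mult \<epsilon> clifford_one x = x"
    by (subst (1 2) x)
      (simp add: clifford_one_def linear_sum [OF bilinear_clifford_mult [unfolded bilinear_def, THEN conjunct1, rule_format]]
        clifford_mult_axis s)
  show "clifford_mult \<epsilon> x clifford_one = x"
    by (subst (1 2) x)
      (simp add: clifford_one_def linear_sum [OF bilinear_clifford_mult [unfolded bilinear_def, THEN conjunct2, rule_format]]
        clifford_mult_axis s)
qed

lemma clifford_mult_basis:
  assumes "\<And>j. j \<in> A \<Longrightarrow> i < j"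
  shows "clifford_mult \<epsilon> (axis {i} 1) (axis A 1) = axis (insert i A) 1"
proof -
  have "i \<notin> A"
    using assms by blast
  then have "sym_diff {i} A = insert i A"
    by auto
  moreover have "(\<Prod>b\<in>A. if b < i then -1 else 1) = (1::real)"
    using assms by (intro prod.neutral) (auto dest: less_asym)
  with \<open>i \<notin> A\<close> have "clifford_sign \<epsilon> {i} A = 1"
    by (simp add: clifford_sign_alt)
  ultimately show ?thesis
    by (simp add: clifford_mult_axis)
qed

lemma clifford_vec_square:
  "clifford_mult \<epsilon> (clifford_vec v) (clifford_vec v) = diagonal_form \<epsilon> v *\<^sub>R clifford_one"
proof -
  define t where "t i j = axis (sym_diff {i} {j}) (clifford_sign \<epsilon> {i} {j} * v $ i * v $ j)" for i j
  have t: "t i j + t j i = (if i = j then (2 * (\<epsilon> i * (v $ i)\<^sup>2)) *\<^sub>R clifford_one else 0)" for i j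
  proof -
    have "sym_diff {j} {i} = sym_diff {i} {j}" by auto
    then show ?thesis
      by (cases i j rule: linorder_cases)
        (auto simp: t_def vec_eq_iff axis_def clifford_one_def clifford_sign_alt power2_eq_square)
  qed
  have v: "clifford_mult \<epsilon> (clifford_vec v) (clifford_vec v) = (\<Sum>i\<in>UNIV. \<Sum>j\<in>UNIV. t i j)"
    by (simp add: clifford_vec_def bilinear_sum [OF bilinear_clifford_mult]
        clifford_mult_axis t_def sum.cartesian_product)
  have "2 *\<^sub>R clifford_mult \<epsilon> (clifford_vec v) (clifford_vec v) =
        (\<Sum>i\<in>UNIV. \<Sum>j\<in>UNIV. t i j) + (\<Sum>i\<in>UNIV. \<Sum>j\<in>UNIV. t j i)"
    unfolding v by (subst (3) sum.swap) (simp add: scaleR_2)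
  also have "\<dots> = (\<Sum>i\<in>UNIV. (2 * (\<epsilon> i * (v $ i)\<^sup>2)) *\<^sub>R clifford_one)"
    by (simp add: sum.distrib [symmetric] t)
  also have "\<dots> = 2 *\<^sub>R (diagonal_form \<epsilon> v *\<^sub>R clifford_one)"
    by (simp add: diagonal_form_def sum_distrib_left scaleR_sum_left scaleR_sum_right)
  finally show ?thesis
    by (rule scaleR_left_imp_eq [rotated]) simp
qed

end

(*
  Elements (s, x, t) of R x C x R are regarded as Hermitian 2x2 matrices X over C; minus the
  determinant, Q x - s t, has signature (p + 1, q + 1).  With X~ the adjugate of X, alternativity
  gives L_X L_X~ = det X, so (u, w) |-> (L_X w, - L_X~ u) defines a Clifford action on C^2 + C^2.
  The first half-spin action maps a product X_1 Y_1 X_2 Y_2 ... to the product of the - L_X L_Y~.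

  The image of Spin lies in SL_2(C), because an LDU decomposition puts L_X into SL_2(C) if det X = 1
  and into diag(-1, 1) SL_2(C) if det X = -1, and diag(-1, 1) normalises SL_2(C).  It contains the
  generators I + a E_ij with Q a nonzero, which are products of two vectors, and every a is a sum of
  two vectors of nonzero norm.

  For injectivity: L_X is self-adjoint for the polar form on C^2, so on elements of spinor norm 1 the
  second half-spin action is the inverse adjoint of the first, while the sum of the two is faithful on
  the whole Clifford algebra, since the operators of all nontrivial basis products have trace 0.  The
  coefficients of a spin element are thus traces against its image and the inverse of its image, so
  that the inverse isomorphism is smooth.  No classification of composition algebras is needed.
*)
theory Submission
  imports Defs
begin

section \<open>Representations of Clifford algebras\<close>

interpretation blinfun_compose: bounded_bilinear "(o\<^sub>L)"
  by (rule bounded_bilinear_blinfun_compose)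

lemma blinfun_compose_assoc: "(R o\<^sub>L S) o\<^sub>L T = R o\<^sub>L (S o\<^sub>L T)"
  by (rule blinfun_eqI) simp

lemma blinfun_compose_id [simp]: "id_blinfun o\<^sub>L T = T" "T o\<^sub>L id_blinfun = T"
  by (auto intro: blinfun_eqI)

section \<open>Traces of operators\<close>

definition blinfun_trace :: "('s::euclidean_space \<Rightarrow>\<^sub>L 's) \<Rightarrow> real" where
  "blinfun_trace T = (\<Sum>b\<in>Basis. blinfun_apply T b \<bullet> b)"

lemma linear_blinfun_trace: "linear blinfun_trace"
  unfolding blinfun_trace_def
  by (rule linearI) (simp_all add: blinfun.bilinear_simps inner_left_distrib sum.distrib sum_distrib_left)

lemma blinfun_trace_id: "blinfun_trace (id_blinfun :: 's::euclidean_space \<Rightarrow>\<^sub>L 's) = DIM('s)"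
  by (simp add: blinfun_trace_def)

lemma blinfun_trace_commute:
  fixes S T :: "'s::euclidean_space \<Rightarrow>\<^sub>L 's"
  shows "blinfun_trace (S o\<^sub>L T) = blinfun_trace (T o\<^sub>L S)"
proof -
  have *: "blinfun_trace (S o\<^sub>L T) = (\<Sum>b\<in>Basis. \<Sum>c\<in>Basis. (T b \<bullet> c) * (S c \<bullet> b))" for S T :: "'s \<Rightarrow>\<^sub>L 's"
  proof -
    have "S (T b) \<bullet> b = (\<Sum>c\<in>Basis. (T b \<bullet> c) * (S c \<bullet> b))" for b
      by (subst euclidean_representation [of "T b", symmetric])
        (simp add: blinfun.sum_right blinfun.scaleR_right inner_sum_left)
    then show ?thesis by (simp add: blinfun_trace_def)
  qed
  show ?thesis
    unfolding * by (subst sum.swap) (simp only: mult.commute)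
qed

section \<open>Representations from operators satisfying the Clifford relations\<close>

locale clifford_rep =
  fixes \<epsilon> :: "'n::{finite,linorder} \<Rightarrow> real" and \<gamma> :: "'n \<Rightarrow> ('s::euclidean_space \<Rightarrow>\<^sub>L 's)"
  assumes square: "\<gamma> i o\<^sub>L \<gamma> i = \<epsilon> i *\<^sub>R id_blinfun"
    and anticommute: "i \<noteq> j \<Longrightarrow> \<gamma> i o\<^sub>L \<gamma> j = - (\<gamma> j o\<^sub>L \<gamma> i)"
begin

text \<open>The factors are taken in increasing order because \<open>axis A 1\<close> is the
  increasing product of the generators in \<open>A\<close>; this makes \<open>rep\<close> compatible
  with the signs in \<open>clifford_mult\<close>.\<close>

definition rep_basis :: "'n set \<Rightarrow> ('s \<Rightarrow>\<^sub>L 's)" where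
  "rep_basis A = foldr (\<lambda>i T. \<gamma> i o\<^sub>L T) (sorted_list_of_set A) id_blinfun"

definition rep :: "real ^ ('n set) \<Rightarrow> ('s \<Rightarrow>\<^sub>L 's)" where
  "rep x = (\<Sum>A\<in>UNIV. x $ A *\<^sub>R rep_basis A)"

lemma rep_basis_empty: "rep_basis {} = id_blinfun"
  by (simp add: rep_basis_def)

lemma rep_basis_insert:
  assumes "\<And>j. j \<in> A \<Longrightarrow> i < j"
  shows "rep_basis (insert i A) = \<gamma> i o\<^sub>L rep_basis A"
proof -
  have "i \<notin> A" "finite A" using assms by auto
  moreover have "insort i (sorted_list_of_set A) = i # sorted_list_of_set A"
    using assms by (intro insort_is_Cons) (auto intro: less_imp_le)
  ultimately have "sorted_list_of_set (insert i A) = i # sorted_list_of_set A"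
    by simp
  then show ?thesis by (simp add: rep_basis_def)
qed

text \<open>Each factor of \<open>rep_basis A\<close> passes through \<open>T\<close> at the cost of
  one scalar. The lemma is applied to the grading and to a single generator, where the scalars are
  signs.\<close>

lemma rep_basis_commute:
  assumes "\<And>j. T o\<^sub>L \<gamma> j = s j *\<^sub>R (\<gamma> j o\<^sub>L T)"
  shows "T o\<^sub>L rep_basis A = prod s A *\<^sub>R (rep_basis A o\<^sub>L T)"
proof (induction A rule: finite_linorder_min_induct [OF finite])
  case 1
  then show ?case by (simp add: rep_basis_empty)
next
  case (2 m A)
  then have "m \<notin> A" by auto
  have "T o\<^sub>L rep_basis (insert m A) = (T o\<^sub>L \<gamma> m) o\<^sub>L rep_basis A"
    using 2 by (simp add: rep_basis_insert blinfun_compose_assoc)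
  also have "\<dots> = s m *\<^sub>R (\<gamma> m o\<^sub>L (T o\<^sub>L rep_basis A))"
    by (simp add: assms blinfun_compose.scaleR_left blinfun_compose_assoc)
  finally show ?case
    using 2 \<open>m \<notin> A\<close> by (simp add: rep_basis_insert blinfun_compose_assoc blinfun_compose.scaleR_right)
qed

text \<open>Induction on the least element \<open>m\<close> of the set: for \<open>i < m\<close> the
  product is already in increasing order, for \<open>i = m\<close> the square collapses to
  \<open>\<epsilon> m\<close>, and for \<open>m < i\<close> moving \<open>\<gamma> i\<close> past
  \<open>\<gamma> m\<close> costs one sign, the additional inversion counted by
  \<open>clifford_sign\<close>.\<close>

lemma generator_rep_basis:
  "\<gamma> i o\<^sub>L rep_basis A = clifford_sign \<epsilon> {i} A *\<^sub>R rep_basis (sym_diff {i} A)"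
proof (induction A rule: finite_linorder_min_induct [OF finite])
  case 1
  have "rep_basis {i} = \<gamma> i o\<^sub>L rep_basis {}" by (rule rep_basis_insert) simp
  then show ?case by (simp add: clifford_sign_alt)
next
  case (2 m A)
  then have m: "m \<notin> A" "\<And>j. j \<in> A \<Longrightarrow> m < j" by auto
  have ins: "rep_basis (insert m A) = \<gamma> m o\<^sub>L rep_basis A"
    using m by (intro rep_basis_insert) auto
  note IH = 2(3)
  consider "i < m" | "i = m" | "m < i" by (rule linorder_cases)
  then show ?case
  proof cases
    case 1
    then have *: "j \<in> insert m A \<Longrightarrow> i < j" for j using m less_trans by blast
    then have "sym_diff {i} (insert m A) = insert i (insert m A)" by auto
    moreover have "clifford_sign \<epsilon> {i} (insert m A) = 1"
    proof -
      have "(\<Prod>b\<in>insert m A. if b < i then -1 else 1) = (1::real)"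
        using * by (intro prod.neutral) (auto dest: less_asym)
      moreover have "{i} \<inter> insert m A = {}" using * by auto
      ultimately show ?thesis unfolding clifford_sign_alt by simp
    qed
    ultimately show ?thesis using rep_basis_insert [of "insert m A" i, OF *] by simp
  next
    case 2
    have "sym_diff {i} (insert m A) = A" using 2 m by auto
    moreover have "clifford_sign \<epsilon> {i} (insert m A) = \<epsilon> m"
    proof -
      have "(\<Prod>b\<in>insert m A. if b < i then -1 else 1) = (1::real)"
        using m 2 by (intro prod.neutral) (auto dest: less_asym)
      moreover have "{i} \<inter> insert m A = {m}" using 2 by auto
      ultimately show ?thesis unfolding clifford_sign_alt by simp
    qed
    moreover have "\<gamma> m o\<^sub>L (\<gamma> m o\<^sub>L rep_basis A) = \<epsilon> m *\<^sub>R rep_basis A"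
      by (simp add: blinfun_compose_assoc [symmetric] square blinfun_compose.scaleR_left)
    ultimately show ?thesis using 2 by (simp add: ins)
  next
    case 3
    have "sym_diff {i} (insert m A) = insert m (sym_diff {i} A)" using 3 m by auto
    moreover have "rep_basis (insert m (sym_diff {i} A)) = \<gamma> m o\<^sub>L rep_basis (sym_diff {i} A)"
      using 3 m by (intro rep_basis_insert) auto
    moreover have "clifford_sign \<epsilon> {i} (insert m A) = - clifford_sign \<epsilon> {i} A"
    proof -
      have "{i} \<inter> insert m A = {i} \<inter> A" using 3 by auto
      then show ?thesis using m 3 by (simp add: clifford_sign_alt)
    qed
    moreover have "\<gamma> i o\<^sub>L (\<gamma> m o\<^sub>L rep_basis A) = - (\<gamma> m o\<^sub>L (\<gamma> i o\<^sub>L rep_basis A))"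
      using 3 by (simp add: blinfun_compose_assoc [symmetric] anticommute [of i m] blinfun_compose.minus_left)
    ultimately show ?thesis
      by (simp add: ins IH blinfun_compose.scaleR_right)
  qed
qed

lemma linear_rep: "linear rep"
  unfolding rep_def by (rule linearI) (simp_all add: scaleR_left_distrib sum.distrib scaleR_sum_right)

lemma rep_axis: "rep (axis A a) = a *\<^sub>R rep_basis A"
proof -
  have "rep (axis A a) = (\<Sum>B\<in>UNIV. if B = A then a *\<^sub>R rep_basis A else 0)"
    unfolding rep_def by (rule sum.cong) (auto simp: axis_def)
  then show ?thesis by simp
qed

lemma rep_one: "rep clifford_one = id_blinfun"
  by (simp add: clifford_one_def rep_axis rep_basis_empty)

lemma rep_vec: "rep (clifford_vec v) = (\<Sum>i\<in>UNIV. v $ i *\<^sub>R \<gamma> i)"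
proof -
  have "rep_basis {i} = \<gamma> i" for i
    using rep_basis_insert [of "{}" i] by (simp add: rep_basis_empty)
  then show ?thesis
    by (simp add: clifford_vec_def linear_sum [OF linear_rep] rep_axis)
qed

lemma axis_expansion: "x = (\<Sum>A\<in>UNIV. x $ A *\<^sub>R axis A 1)" for x :: "real ^ 'k"
  by (simp add: vec_eq_iff axis_def if_distrib [where f = "\<lambda>t. _ * t"] cong: if_cong)

lemma rep_generator_mult: "rep (clifford_mult \<epsilon> (axis {i} 1) x) = \<gamma> i o\<^sub>L rep x"
proof -
  have l: "linear (\<lambda>x. rep (clifford_mult \<epsilon> (axis {i} 1) x))"
    using linear_compose [OF _ linear_rep] bilinear_clifford_mult [of \<epsilon>]
    unfolding bilinear_def o_def by blast
  have "rep (clifford_mult \<epsilon> (axis {i} 1) x) =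
      (\<Sum>A\<in>UNIV. x $ A *\<^sub>R rep (clifford_mult \<epsilon> (axis {i} 1) (axis A 1)))"
    by (subst axis_expansion [of x]) (simp only: linear_sum [OF l] linear_cmul [OF l])
  also have "\<dots> = (\<Sum>A\<in>UNIV. x $ A *\<^sub>R (\<gamma> i o\<^sub>L rep_basis A))"
    by (simp add: clifford_mult_axis rep_axis generator_rep_basis)
  also have "\<dots> = \<gamma> i o\<^sub>L rep x"
    by (simp add: rep_def blinfun_compose.sum_right blinfun_compose.scaleR_right)
  finally show ?thesis .
qed

text \<open>The least generator is split off \<open>axis A 1\<close> and off
  \<open>rep_basis A\<close>, which reduces the claim to \<open>rep_generator_mult\<close>;
  associativity of the Clifford product enters here.\<close>

lemma rep_axis_mult: "rep (clifford_mult \<epsilon> (axis A 1) x) = rep_basis A o\<^sub>L rep x"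
proof (induction A rule: finite_linorder_min_induct [OF finite])
  case 1
  then show ?case
    using clifford_mult_one(1) [of \<epsilon> x] by (simp add: rep_basis_empty clifford_one_def)
next
  case (2 m A)
  then show ?case
    by (simp add: rep_basis_insert clifford_mult_basis [of A m \<epsilon>, symmetric] clifford_mult_assoc
        rep_generator_mult blinfun_compose_assoc)
qed

lemma rep_mult: "rep (clifford_mult \<epsilon> x y) = rep x o\<^sub>L rep y"
proof -
  have l: "linear (\<lambda>x. rep (clifford_mult \<epsilon> x y))"
    using linear_compose [OF _ linear_rep] bilinear_clifford_mult [of \<epsilon>]
    unfolding bilinear_def o_def by blast
  have "rep (clifford_mult \<epsilon> x y) = (\<Sum>A\<in>UNIV. x $ A *\<^sub>R rep (clifford_mult \<epsilon> (axis A 1) y))"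
    by (subst axis_expansion [of x]) (simp only: linear_sum [OF l] linear_cmul [OF l])
  also have "\<dots> = rep x o\<^sub>L rep y"
    by (simp add: rep_axis_mult rep_def [of x] blinfun_compose.sum_left blinfun_compose.scaleR_left)
  finally show ?thesis .
qed

lemma rep_basis_mult:
  "rep_basis A o\<^sub>L rep_basis B = clifford_sign \<epsilon> A B *\<^sub>R rep_basis (sym_diff A B)"
  using rep_axis_mult [of A "axis B 1"] by (simp add: rep_axis clifford_mult_axis)

end

text \<open>The grading takes care of products of an odd number of generators. If the total number
  of generators is odd, the product of all of them commutes with every generator, so no generator
  could force its trace to vanish.\<close>

locale graded_clifford_rep = clifford_rep +
  fixes \<sigma>
  assumes involution: "\<sigma> o\<^sub>L \<sigma> = id_blinfun"
    and odd_generators: "\<sigma> o\<^sub>L \<gamma> i = - (\<gamma> i o\<^sub>L \<sigma>)"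
    and nonzero: "\<epsilon> i \<noteq> 0"
begin

text \<open>Some invertible operator, a generator or the grading, anticommutes with \<open>rep_basis A\<close>.\<close>

lemma trace_rep_basis:
  assumes "A \<noteq> {}"
  shows "blinfun_trace (rep_basis A) = 0"
proof -
  \<comment> \<open>Cyclicity turns the trace of \<open>rep_basis A o\<^sub>L T o\<^sub>L T\<close>
    into that of \<open>T o\<^sub>L rep_basis A o\<^sub>L T\<close>, and anticommutation makes this
    its own negative.\<close>
  have key: "blinfun_trace (rep_basis A) = 0"
    if "T o\<^sub>L rep_basis A = - (rep_basis A o\<^sub>L T)" "T o\<^sub>L T = c *\<^sub>R id_blinfun" "c \<noteq> 0" for T c
  proof -
    have "c * blinfun_trace (rep_basis A) = blinfun_trace (rep_basis A o\<^sub>L (T o\<^sub>L T))"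
      by (simp add: that(2) blinfun_compose.scaleR_right linear_cmul [OF linear_blinfun_trace])
    also have "\<dots> = blinfun_trace (T o\<^sub>L (rep_basis A o\<^sub>L T))"
      by (simp add: blinfun_compose_assoc [symmetric] blinfun_trace_commute [of _ T])
    also have "\<dots> = - blinfun_trace (rep_basis A o\<^sub>L (T o\<^sub>L T))"
      by (simp add: that(1) blinfun_compose_assoc [symmetric] blinfun_compose.minus_left
          linear_neg [OF linear_blinfun_trace])
    also have "\<dots> = - (c * blinfun_trace (rep_basis A))"
      by (simp add: that(2) blinfun_compose.scaleR_right linear_cmul [OF linear_blinfun_trace])
    finally show ?thesis using \<open>c \<noteq> 0\<close> by simp
  qed
  show ?thesis
  proof (cases "even (card A)")
    case False
    have "\<sigma> o\<^sub>L rep_basis A = (\<Prod>j\<in>A. -1) *\<^sub>R (rep_basis A o\<^sub>L \<sigma>)"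
      by (rule rep_basis_commute) (simp add: odd_generators)
    then show ?thesis
      using False by (intro key [of \<sigma> 1]) (simp_all add: involution)
  next
    case True
    obtain i where i: "i \<in> A" using assms by blast
    \<comment> \<open>\<open>\<gamma> i\<close> commutes with its own factor and anticommutes with
      the remaining \<open>card A - 1\<close> factors, an odd number.\<close>
    have "\<gamma> i o\<^sub>L rep_basis A = (\<Prod>j\<in>A. if j = i then 1 else -1) *\<^sub>R (rep_basis A o\<^sub>L \<gamma> i)"
      using anticommute [of i] by (intro rep_basis_commute) auto
    also have "(\<Prod>j\<in>A. if j = i then 1 else -1) = (\<Prod>j\<in>A - {i}. -1::real)"
      using i by (simp add: prod.remove [of A i])
    also have "\<dots> = -1"
    proof -
      have "card A = Suc (card (A - {i}))" using i card_Suc_Diff1 [of A i] by simp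
      then show ?thesis using True by simp
    qed
    finally show ?thesis
      by (intro key [of "\<gamma> i" "\<epsilon> i"]) (simp_all add: square nonzero)
  qed
qed

lemma clifford_sign_self_nonzero: "clifford_sign \<epsilon> A A \<noteq> 0"
  by (simp add: clifford_sign_def nonzero)

text \<open>By \<open>trace_rep_basis\<close> distinct basis operators are orthogonal for the trace
  form, and \<open>rep_basis A\<close> pairs with itself to
  \<open>clifford_sign \<epsilon> A A\<close> times the dimension. Hence \<open>rep\<close> is
  faithful, and linear functionals recover the coefficients.\<close>

lemma rep_coefficient:
  "x $ A = blinfun_trace (rep_basis A o\<^sub>L rep x) / (clifford_sign \<epsilon> A A * DIM('b))"
proof -
  have "blinfun_trace (rep_basis A o\<^sub>L rep x) =
      (\<Sum>B\<in>UNIV. x $ B * blinfun_trace (rep_basis A o\<^sub>L rep_basis B))"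
    by (simp add: rep_def blinfun_compose.sum_right blinfun_compose.scaleR_right
        linear_sum [OF linear_blinfun_trace] linear_cmul [OF linear_blinfun_trace])
  also have "\<dots> = (\<Sum>B\<in>UNIV. if B = A then x $ A * (clifford_sign \<epsilon> A A * DIM('b)) else 0)"
  proof (rule sum.cong [OF refl])
    fix B
    have "sym_diff A B \<noteq> {}" if "B \<noteq> A" using that by auto
    then show "x $ B * blinfun_trace (rep_basis A o\<^sub>L rep_basis B) =
        (if B = A then x $ A * (clifford_sign \<epsilon> A A * DIM('b)) else 0)"
      by (simp add: rep_basis_mult linear_cmul [OF linear_blinfun_trace] trace_rep_basis
          rep_basis_empty blinfun_trace_id)
  qed
  finally show ?thesis
    by (simp add: clifford_sign_self_nonzero)
qed

end

section \<open>Smoothness of inversion\<close>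

text \<open>Finite dimension enters through the matrix units \<open>E b c\<close>: every
  \<open>T\<close> is a combination of them with coefficients at most \<open>norm T\<close>. This
  makes the linear parts of the inverse isomorphism smooth.\<close>

lemma linear_blinfun_bounded:
  fixes L :: "('a::euclidean_space \<Rightarrow>\<^sub>L 'b::euclidean_space) \<Rightarrow> 'c::real_normed_vector"
  assumes "linear L"
  shows "bounded_linear L"
proof -
  define E where "E b c = blinfun_of_matrix (\<lambda>i j. if i = b \<and> j = c then 1 else 0)" for b :: 'b and c :: 'a
  have T: "T = (\<Sum>b\<in>Basis. \<Sum>c\<in>Basis. (T c \<bullet> b) *\<^sub>R E b c)" for T :: "'a \<Rightarrow>\<^sub>L 'b"
  proof (rule blinfun_eqI)
    fix x
    have E: "E b c x = (x \<bullet> c) *\<^sub>R b" if "b \<in> Basis" "c \<in> Basis" for b c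
    proof -
      have "E b c x = (\<Sum>i\<in>Basis. if i = b then (x \<bullet> c) *\<^sub>R b else 0)"
        unfolding E_def blinfun_of_matrix_apply
      proof (rule sum.cong [OF refl])
        fix i
        have "(\<Sum>j\<in>Basis. ((x \<bullet> j) * (if i = b \<and> j = c then 1 else 0)) *\<^sub>R i) =
            (\<Sum>j\<in>Basis. if j = c then (if i = b then (x \<bullet> c) *\<^sub>R b else 0) else 0)"
          by (rule sum.cong) auto
        then show "(\<Sum>j\<in>Basis. ((x \<bullet> j) * (if i = b \<and> j = c then 1 else 0)) *\<^sub>R i) =
            (if i = b then (x \<bullet> c) *\<^sub>R b else 0)"
          using that by simp
      qed
      then show ?thesis using that by simp
    qed
    have "T x = blinfun_of_matrix (\<lambda>i j. T j \<bullet> i) x"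
      by (simp only: blinfun_of_matrix_works)
    also have "\<dots> = (\<Sum>b\<in>Basis. \<Sum>c\<in>Basis. (T c \<bullet> b) *\<^sub>R E b c x)"
      unfolding blinfun_of_matrix_apply by (intro sum.cong refl) (simp add: E)
    also have "\<dots> = (\<Sum>b\<in>Basis. \<Sum>c\<in>Basis. (T c \<bullet> b) *\<^sub>R E b c) x"
      by (simp add: blinfun.sum_left blinfun.scaleR_left)
    finally show "T x = (\<Sum>b\<in>Basis. \<Sum>c\<in>Basis. (T c \<bullet> b) *\<^sub>R E b c) x" .
  qed
  have "norm (L T) \<le> norm T * (\<Sum>b\<in>Basis. \<Sum>c\<in>Basis. norm (L (E b c)))" for T
  proof -
    have "L T = (\<Sum>b\<in>Basis. \<Sum>c\<in>Basis. (T c \<bullet> b) *\<^sub>R L (E b c))"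
      by (subst T) (simp only: linear_sum [OF assms] linear_cmul [OF assms])
    also have "norm \<dots> \<le> (\<Sum>b\<in>Basis. \<Sum>c\<in>Basis. norm T * norm (L (E b c)))"
    proof (intro sum_norm_le)
      fix b :: 'b and c :: 'a
      assume "b \<in> Basis" "c \<in> Basis"
      then have "\<bar>T c \<bullet> b\<bar> \<le> norm T"
        using Basis_le_norm [of b "T c"] norm_blinfun [of T c] by simp
      then show "norm ((T c \<bullet> b) *\<^sub>R L (E b c)) \<le> norm T * norm (L (E b c))"
        by (simp add: mult_right_mono)
    qed
    finally show ?thesis by (simp add: sum_distrib_left)
  qed
  then show ?thesis
    using assms by (auto simp: bounded_linear_def bounded_linear_axioms_def)
qed

section \<open>Closure properties of C^k maps\<close>

lemma Ck_on_cong: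
  assumes "open U" "\<And>x. x \<in> U \<Longrightarrow> f x = g x" "Ck_on k f U"
  shows "Ck_on k g U"
  using assms(2,3)
proof (induction k arbitrary: f g)
  case 0
  then show ?case by (simp cong: continuous_on_cong)
next
  case (Suc k)
  have "g differentiable (at x)" if x: "x \<in> U" for x
  proof -
    have "(f has_derivative frechet_derivative f (at x)) (at x)"
      using Suc.prems(2) x by (simp add: frechet_derivative_works)
    then have "(g has_derivative frechet_derivative f (at x)) (at x)"
      by (rule has_derivative_transform_within_open [OF _ \<open>open U\<close> x]) (rule Suc.prems(1))
    then show ?thesis by (auto simp: differentiable_def)
  qed
  moreover have "frechet_derivative f (at x) v = frechet_derivative g (at x) v" if x: "x \<in> U" for x v
  proof -
    have "f differentiable (at x)" using Suc.prems(2) x by simp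
    then have "frechet_derivative f (at x) = frechet_derivative g (at x)"
      by (rule frechet_derivative_transform_within_open [OF _ \<open>open U\<close> x]) (rule Suc.prems(1))
    then show ?thesis by simp
  qed
  then have "Ck_on k (\<lambda>x. frechet_derivative g (at x) v) U" for v
    by (rule Suc.IH) (use Suc.prems(2) in simp_all)
  ultimately show ?case by simp
qed

text \<open>Uniqueness of derivatives lets an explicit formula replace
  \<open>frechet_derivative\<close>; the inductions on \<open>k\<close> below all proceed through
  this rule.\<close>

lemma Ck_on_has_derivativeI:
  assumes "open U" "\<And>x. x \<in> U \<Longrightarrow> (f has_derivative f' x) (at x)"
    and "\<And>v. Ck_on k (\<lambda>x. f' x v) U"
  shows "Ck_on (Suc k) f U"
proof -
  have "f' x = frechet_derivative f (at x)" if "x \<in> U" for x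
    using frechet_derivative_at [OF assms(2) [OF that]] .
  then have "Ck_on k (\<lambda>x. frechet_derivative f (at x) v) U" for v
    by (intro Ck_on_cong [OF assms(1) _ assms(3)]) simp
  then show ?thesis
    using assms(2) by (auto simp: differentiable_def)
qed

lemma Ck_on_Suc_has_derivative:
  "Ck_on (Suc k) f U \<Longrightarrow> x \<in> U \<Longrightarrow> (f has_derivative frechet_derivative f (at x)) (at x)"
  by (simp add: frechet_derivative_works)

lemma Ck_on_SucD: "Ck_on (Suc k) f U \<Longrightarrow> Ck_on k f U"
proof (induction k arbitrary: f)
  case 0
  then show ?case
    by (auto intro!: differentiable_imp_continuous_on differentiable_at_imp_differentiable_on)
next
  case (Suc k)
  then show ?case by simp
qed

lemma Ck_on_const: "Ck_on k (\<lambda>x. c) U"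
  by (induction k arbitrary: c) simp_all

lemma Ck_on_add:
  assumes "open U" "Ck_on k f U" "Ck_on k g U"
  shows "Ck_on k (\<lambda>x. f x + g x) U"
  using assms(2,3)
proof (induction k arbitrary: f g)
  case 0
  then show ?case by (simp add: continuous_on_add)
next
  case (Suc k)
  show ?case
  proof (rule Ck_on_has_derivativeI [OF \<open>open U\<close>])
    show "((\<lambda>x. f x + g x) has_derivative
        (\<lambda>v. frechet_derivative f (at x) v + frechet_derivative g (at x) v)) (at x)" if "x \<in> U" for x
      using Suc.prems that by (intro has_derivative_add Ck_on_Suc_has_derivative)
  qed (use Suc in simp)
qed

text \<open>The product rule expresses the directional derivatives through \<open>h\<close> again,
  so the induction hypothesis applies once the undifferentiated factors are lowered to order
  \<open>k\<close>.\<close>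

lemma Ck_on_bilinear:
  assumes "bounded_bilinear h" "open U" "Ck_on k f U" "Ck_on k g U"
  shows "Ck_on k (\<lambda>x. h (f x) (g x)) U"
  using assms(3,4)
proof (induction k arbitrary: f g)
  case 0
  then show ?case by (simp add: bounded_bilinear.continuous_on [OF assms(1)])
next
  case (Suc k)
  show ?case
  proof (rule Ck_on_has_derivativeI [OF \<open>open U\<close>])
    show "((\<lambda>x. h (f x) (g x)) has_derivative
        (\<lambda>v. h (f x) (frechet_derivative g (at x) v) + h (frechet_derivative f (at x) v) (g x))) (at x)"
      if "x \<in> U" for x
      using Suc.prems that by (intro bounded_bilinear.FDERIV [OF assms(1)] Ck_on_Suc_has_derivative)
    show "Ck_on k (\<lambda>x. h (f x) (frechet_derivative g (at x) v) +
        h (frechet_derivative f (at x) v) (g x)) U" for v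
      using Suc.prems by (intro Ck_on_add [OF \<open>open U\<close>] Suc.IH Ck_on_SucD [of k f] Ck_on_SucD [of k g]) simp_all
  qed
qed

lemma Ck_on_bounded_linear:
  assumes "bounded_linear h" "open U"
  shows "Ck_on k f U \<Longrightarrow> Ck_on k (\<lambda>x. h (f x)) U"
proof (induction k arbitrary: f)
  case 0
  then show ?case by (simp add: bounded_linear.continuous_on [OF assms(1)])
next
  case (Suc k)
  show ?case
  proof (rule Ck_on_has_derivativeI [OF \<open>open U\<close>])
    show "((\<lambda>x. h (f x)) has_derivative (\<lambda>v. h (frechet_derivative f (at x) v))) (at x)"
      if "x \<in> U" for x
      using Suc.prems that by (intro bounded_linear.has_derivative [OF assms(1)] Ck_on_Suc_has_derivative)
  qed (use Suc in simp)
qed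

lemma bounded_linear_Ck_on:
  assumes "bounded_linear h" "open U"
  shows "Ck_on k h U"
proof (cases k)
  case 0
  then show ?thesis by (simp add: assms(1) linear_continuous_on)
next
  case (Suc m)
  show ?thesis
    unfolding Suc
    by (rule Ck_on_has_derivativeI [OF assms(2)])
      (auto intro: bounded_linear_imp_has_derivative assms(1) Ck_on_const)
qed

section \<open>Invertible operators and the inversion map\<close>

definition blinfun_inverse :: "('a::real_normed_vector \<Rightarrow>\<^sub>L 'a) \<Rightarrow> ('a \<Rightarrow>\<^sub>L 'a)" where
  "blinfun_inverse A = (SOME B. A o\<^sub>L B = id_blinfun \<and> B o\<^sub>L A = id_blinfun)"

definition blinfun_units :: "('a::real_normed_vector \<Rightarrow>\<^sub>L 'a) set" where
  "blinfun_units = {A. \<exists>B. A o\<^sub>L B = id_blinfun \<and> B o\<^sub>L A = id_blinfun}"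

lemma blinfun_inverse_works:
  assumes "A \<in> blinfun_units"
  shows "A o\<^sub>L blinfun_inverse A = id_blinfun" "blinfun_inverse A o\<^sub>L A = id_blinfun"
  using assms someI_ex [of "\<lambda>B. A o\<^sub>L B = id_blinfun \<and> B o\<^sub>L A = id_blinfun"]
  by (auto simp: blinfun_units_def blinfun_inverse_def)

lemma blinfun_units_injectiveI:
  fixes A :: "'a::euclidean_space \<Rightarrow>\<^sub>L 'a"
  assumes "\<And>x. A x = 0 \<Longrightarrow> x = 0"
  shows "A \<in> blinfun_units"
proof -
  have lin: "linear (blinfun_apply A)"
    by (rule bounded_linear.linear) (rule blinfun.bounded_linear_right)
  have "inj (blinfun_apply A)"
    using assms by (simp add: linear_injective_0 [OF lin])
  then obtain D where D: "linear D" "\<And>x. D (A x) = x" "\<And>x. A (D x) = x"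
    using linear_injective_isomorphism [OF lin] by blast
  then have "A o\<^sub>L Blinfun D = id_blinfun \<and> Blinfun D o\<^sub>L A = id_blinfun"
    by (auto intro!: blinfun_eqI simp: bounded_linear_Blinfun_apply linear_conv_bounded_linear)
  then show ?thesis by (auto simp: blinfun_units_def)
qed

text \<open>If \<open>C\<close> is close to an invertible \<open>A\<close> with inverse
  \<open>B\<close>, a kernel vector of \<open>C\<close> satisfies \<open>x = B ((A - C) x)\<close>
  and would be shorter than itself; in finite dimension a trivial kernel gives
  invertibility.\<close>

lemma open_blinfun_units: "open (blinfun_units :: ('a::euclidean_space \<Rightarrow>\<^sub>L 'a) set)"
proof (rule openI)
  fix A :: "'a \<Rightarrow>\<^sub>L 'a"
  assume A: "A \<in> blinfun_units"
  define B where "B = blinfun_inverse A"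
  have BA: "B (A x) = x" for x
    using blinfun_inverse_works(2) [OF A]
    by (metis B_def blinfun_apply_blinfun_compose blinfun_apply_id_blinfun)
  \<comment> \<open>The added 1 keeps the denominator positive and gives the strict bound
    \<open>norm B * r < 1\<close>.\<close>
  define r where "r = 1 / (norm B + 1)"
  have r: "r > 0" "norm B * r < 1"
    by (simp_all add: r_def add_nonneg_pos divide_simps)
  have "C \<in> blinfun_units" if "C \<in> ball A r" for C
  proof (rule blinfun_units_injectiveI, rule ccontr)
    fix x
    assume "C x = 0" "x \<noteq> 0"
    then have "x = B ((A - C) x)" using BA by (simp add: blinfun.diff_left)
    then have "norm x \<le> norm B * norm ((A - C) x)"
      using norm_blinfun [of B "(A - C) x"] by simp
    also have "\<dots> \<le> norm B * (norm (A - C) * norm x)"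
      by (intro mult_left_mono norm_blinfun norm_ge_zero)
    also have "\<dots> \<le> norm B * (r * norm x)"
      using \<open>C \<in> ball A r\<close> by (intro mult_left_mono mult_right_mono) (auto simp: dist_norm)
    also have "\<dots> = (norm B * r) * norm x" by (rule mult.assoc [symmetric])
    also have "\<dots> < 1 * norm x" using r(2) \<open>x \<noteq> 0\<close> by (intro mult_strict_right_mono) auto
    finally show False by simp
  qed
  then show "\<exists>e>0. ball A e \<subseteq> blinfun_units" using r(1) by blast
qed

text \<open>For \<open>D\<close> the inverse of \<open>C\<close>, the resolvent identity
  \<open>D = B - D (C - A) B\<close>, used twice, leaves the remainder
  \<open>D (C - A) B (C - A) B\<close>, which is quadratic in \<open>C - A\<close>.\<close>

lemma has_derivative_blinfun_inverse:
  fixes A :: "'a::euclidean_space \<Rightarrow>\<^sub>L 'a"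
  assumes A: "A \<in> blinfun_units"
  shows "(blinfun_inverse has_derivative
    (\<lambda>H. - (blinfun_inverse A o\<^sub>L (H o\<^sub>L blinfun_inverse A)))) (at A)"
proof -
  define B where "B = blinfun_inverse A"
  have BA: "A o\<^sub>L B = id_blinfun" "B o\<^sub>L A = id_blinfun"
    using blinfun_inverse_works [OF A] by (simp_all add: B_def)
  obtain r where r: "r > 0" "ball A r \<subseteq> blinfun_units"
    using open_blinfun_units A by (meson open_contains_ball)
  \<comment> \<open>The factor \<open>2 * (norm B + 1)\<close> will bound \<open>norm D\<close>; the
    other two factors \<open>norm B + 1\<close> bound the two occurrences of \<open>B\<close> in the
    remainder.\<close>
  define K where "K = 2 * (norm B + 1) ^ 3"
  have K: "K > 0" unfolding K_def by (intro mult_pos_pos zero_less_power add_nonneg_pos) auto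
  have est: "norm (blinfun_inverse C - B + (B o\<^sub>L ((C - A) o\<^sub>L B))) \<le> K * norm (C - A) * norm (C - A)"
    if C: "norm (C - A) < r" "norm (C - A) * (norm B + 1) \<le> 1 / 2" for C
  proof -
    define D where "D = blinfun_inverse C"
    have "C \<in> blinfun_units" using C r by (auto simp: dist_norm norm_minus_commute)
    then have D: "C o\<^sub>L D = id_blinfun" "D o\<^sub>L C = id_blinfun"
      by (simp_all add: blinfun_inverse_works D_def)
    define Y where "Y = D o\<^sub>L ((C - A) o\<^sub>L B)"
    have "Y = (D o\<^sub>L (C o\<^sub>L B)) - (D o\<^sub>L (A o\<^sub>L B))"
      by (simp add: Y_def blinfun_compose.diff_left blinfun_compose.diff_right)
    also have "D o\<^sub>L (C o\<^sub>L B) = B" by (simp add: blinfun_compose_assoc [symmetric] D)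
    finally have DB: "D = B - Y" by (simp add: BA)
    have nb: "norm (X o\<^sub>L ((C - A) o\<^sub>L B)) \<le> norm X * (norm (C - A) * (norm B + 1))" for X :: "'a \<Rightarrow>\<^sub>L 'a"
    proof -
      have "norm (X o\<^sub>L ((C - A) o\<^sub>L B)) \<le> norm X * (norm (C - A) * norm B)"
        by (meson norm_blinfun_compose order_trans mult_left_mono norm_ge_zero)
      also have "\<dots> \<le> norm X * (norm (C - A) * (norm B + 1))"
        by (intro mult_left_mono) auto
      finally show ?thesis .
    qed
    \<comment> \<open>The smallness of \<open>C - A\<close> bounds \<open>norm Y\<close> by half of
      \<open>norm D\<close>, which is then absorbed on the left.\<close>
    have "norm D \<le> norm B + norm Y"
      by (subst DB) (rule norm_triangle_ineq4)
    also have "\<dots> \<le> norm B + norm D * (1 / 2)"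
      using nb [of D] mult_left_mono [OF C(2) norm_ge_zero [of D]] by (simp add: Y_def)
    finally have nD: "norm D \<le> 2 * (norm B + 1)" using norm_ge_zero [of B] by simp
    have "(B - D) o\<^sub>L ((C - A) o\<^sub>L B) = (B o\<^sub>L ((C - A) o\<^sub>L B)) - Y"
      unfolding Y_def by (rule blinfun_compose.diff_left)
    then have "D - B + (B o\<^sub>L ((C - A) o\<^sub>L B)) = (B - D) o\<^sub>L ((C - A) o\<^sub>L B)"
      using DB by simp
    also have "B - D = Y" using DB by simp
    finally have "norm (D - B + (B o\<^sub>L ((C - A) o\<^sub>L B)))
        \<le> norm Y * (norm (C - A) * (norm B + 1))"
      using nb by metis
    also have "\<dots> \<le> (2 * (norm B + 1) * (norm (C - A) * (norm B + 1))) * (norm (C - A) * (norm B + 1))"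
      unfolding Y_def by (intro mult_right_mono order_trans [OF nb] nD) auto
    also have "\<dots> = K * norm (C - A) * norm (C - A)"
      by (simp add: K_def power3_eq_cube)
    finally show ?thesis by (simp add: D_def)
  qed
  show ?thesis
    unfolding has_derivative_at_alt B_def [symmetric]
  proof (intro conjI allI impI)
    show "bounded_linear (\<lambda>H. - (B o\<^sub>L (H o\<^sub>L B)))"
      by (intro bounded_linear_minus bounded_linear_compose [OF blinfun_compose.bounded_linear_right blinfun_compose.bounded_linear_left])
    fix \<epsilon> :: real
    assume "\<epsilon> > 0"
    define d where "d = min r (min (1 / (2 * (norm B + 1))) (\<epsilon> / K))"
    have nB: "norm B + 1 > 0" by (simp add: add_nonneg_pos)
    have "d > 0" using r \<open>\<epsilon> > 0\<close> K nB by (simp add: d_def)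
    moreover have "norm (blinfun_inverse C - B - - (B o\<^sub>L ((C - A) o\<^sub>L B))) \<le> \<epsilon> * norm (C - A)"
      if "norm (C - A) < d" for C
    proof -
      have C: "norm (C - A) < r" "norm (C - A) < 1 / (2 * (norm B + 1))" "norm (C - A) < \<epsilon> / K"
        using that by (simp_all add: d_def)
      then have "norm (C - A) * (norm B + 1) \<le> 1 / 2"
        using nB by (simp add: field_simps)
      then have "norm (blinfun_inverse C - B + (B o\<^sub>L ((C - A) o\<^sub>L B))) \<le> K * norm (C - A) * norm (C - A)"
        using C by (intro est)
      also have "\<dots> \<le> \<epsilon> * norm (C - A)"
        using C(3) K by (intro mult_right_mono) (simp_all add: field_simps)
      finally show ?thesis by simp
    qed
    ultimately show "\<exists>d>0. \<forall>C. norm (C - A) < d \<longrightarrow>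
        norm (blinfun_inverse C - B - - (B o\<^sub>L ((C - A) o\<^sub>L B))) \<le> \<epsilon> * norm (C - A)"
      by blast
  qed
qed

text \<open>Bootstrapping: the derivative of inversion is a product of constants and inversion
  itself, so order \<open>k\<close> yields order \<open>k + 1\<close>.\<close>

lemma Ck_on_blinfun_inverse:
  "Ck_on k blinfun_inverse (blinfun_units :: ('a::euclidean_space \<Rightarrow>\<^sub>L 'a) set)"
proof (induction k)
  case 0
  have "isCont blinfun_inverse A" if "A \<in> blinfun_units" for A :: "'a \<Rightarrow>\<^sub>L 'a"
    using has_derivative_continuous [OF has_derivative_blinfun_inverse [OF that]] .
  then show ?case by (simp add: continuous_at_imp_continuous_on)
next
  case (Suc k)
  show ?case
  proof (rule Ck_on_has_derivativeI [OF open_blinfun_units has_derivative_blinfun_inverse])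
    fix H :: "'a \<Rightarrow>\<^sub>L 'a"
    show "Ck_on k (\<lambda>A. - (blinfun_inverse A o\<^sub>L (H o\<^sub>L blinfun_inverse A))) blinfun_units"
      by (intro Ck_on_bounded_linear [of uminus] Ck_on_bilinear [of "(o\<^sub>L)"] Suc Ck_on_const
          open_blinfun_units bounded_linear_minus bounded_linear_ident bounded_bilinear_blinfun_compose)
  qed
qed

section \<open>Composition algebras and \<open>SL\<^sub>2\<close>\<close>

lemma polar_commute: "polar Q x y = polar Q y x"
  by (simp add: polar_def add.commute)

lemma polar_self:
  assumes "quadratic_form Q"
  shows "polar Q x x = 2 * Q x"
proof -
  have "Q (2 *\<^sub>R x) = 2\<^sup>2 * Q x" using assms by (simp only: quadratic_form_def)
  then show ?thesis by (simp add: polar_def scaleR_2)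
qed

definition pair_vec :: "'a \<Rightarrow> 'a \<Rightarrow> 'a ^ 2" where
  "pair_vec x y = (\<chi> i. if i = 1 then x else y)"

lemma pair_vec_nth [simp]: "pair_vec x y $ 1 = x" "pair_vec x y $ 2 = y"
  by (simp_all add: pair_vec_def)

lemma pair_vec_eq_iff: "u = v \<longleftrightarrow> u $ 1 = v $ 1 \<and> u $ 2 = v $ 2" for u v :: "'a ^ 2"
  by (simp add: vec_eq_iff forall_2)

section \<open>Norm and conjugation in a composition algebra\<close>

locale composition_algebra =
  fixes cmul :: "'a::euclidean_space \<Rightarrow> 'a \<Rightarrow> 'a" (infixl "\<cdot>" 70) and e :: 'a and Q :: "'a \<Rightarrow> real"
  assumes composition: "unital_real_composition_algebra cmul e Q"
begin

lemma bilinear_mult: "bilinear cmul"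
  using composition by (simp add: unital_real_composition_algebra_def)

lemmas mult_simps =
  bilinear_ladd [OF bilinear_mult] bilinear_radd [OF bilinear_mult]
  bilinear_lmul [OF bilinear_mult] bilinear_rmul [OF bilinear_mult]
  bilinear_lneg [OF bilinear_mult] bilinear_rneg [OF bilinear_mult]
  bilinear_lsub [OF bilinear_mult] bilinear_rsub [OF bilinear_mult]
  bilinear_lzero [OF bilinear_mult] bilinear_rzero [OF bilinear_mult]

lemma unit [simp]: "e \<cdot> x = x" "x \<cdot> e = x"
  using composition by (simp_all add: unital_real_composition_algebra_def)

lemma quadratic: "quadratic_form Q"
  using composition by (simp add: unital_real_composition_algebra_def)

lemma bilinear_polar: "bilinear (polar Q)"
  using quadratic by (simp add: quadratic_form_def)

lemmas polar_simps =
  bilinear_ladd [OF bilinear_polar] bilinear_radd [OF bilinear_polar]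
  bilinear_lmul [OF bilinear_polar] bilinear_rmul [OF bilinear_polar]
  bilinear_lneg [OF bilinear_polar] bilinear_rneg [OF bilinear_polar]
  bilinear_lsub [OF bilinear_polar] bilinear_rsub [OF bilinear_polar]
  bilinear_lzero [OF bilinear_polar] bilinear_rzero [OF bilinear_polar]

lemma Q_scale: "Q (r *\<^sub>R x) = r\<^sup>2 * Q x"
  using quadratic by (simp add: quadratic_form_def)

lemma Q_add: "Q (x + y) = Q x + Q y + polar Q x y"
  by (simp add: polar_def)

lemma Q_minus: "Q (- x) = Q x"
  using Q_scale [of "-1" x] by simp

lemma Q_diff: "Q (x - y) = Q x + Q y - polar Q x y"
  using Q_add [of x "- y"] by (simp add: Q_minus polar_simps)

lemma Q_zero [simp]: "Q 0 = 0"
  using Q_scale [of 0 0] by simp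

lemma Q_mult: "Q (x \<cdot> y) = Q x * Q y"
  using composition by (simp add: unital_real_composition_algebra_def)

text \<open>Nondegeneracy in the form of an extensionality principle, by which identities in the
  algebra reduce to identities of the polar form.\<close>

lemma polar_eqI:
  assumes "\<And>w. polar Q x w = polar Q y w"
  shows "x = y"
proof -
  have "polar Q (x - y) w = 0" for w by (simp add: polar_simps assms)
  then have "x - y = 0"
    using composition unfolding unital_real_composition_algebra_def nondegenerate_def by blast
  then show ?thesis by simp
qed

text \<open>Multiplicativity makes \<open>Q e\<close> idempotent; the value 0 would make
  \<open>Q\<close> vanish identically, against nondegeneracy on a nonzero space.\<close>

lemma Q_unit: "Q e = 1"
proof -
  have "Q e \<noteq> 0"
  proof
    assume "Q e = 0"
    then have "Q x = 0" for x using Q_mult [of e x] by simp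
    then have "x = 0" for x :: 'a using polar_eqI [of x 0] by (simp add: polar_def)
    then show False using nonempty_Basis nonzero_Basis by blast
  qed
  then show ?thesis using Q_mult [of e e] by simp
qed

lemma polar_mult_left: "polar Q (x \<cdot> v) (x \<cdot> w) = Q x * polar Q v w"
  using Q_mult [of x "v + w"] Q_mult [of x v] Q_mult [of x w]
  by (simp add: mult_simps Q_add algebra_simps)

text \<open>Polarization of \<open>polar_mult_left\<close> in the left factor; with
  \<open>y = e\<close> it yields the adjoint of a left multiplication.\<close>

lemma polar_mult_left_add:
  "polar Q (x \<cdot> v) (y \<cdot> w) + polar Q (y \<cdot> v) (x \<cdot> w) = polar Q x y * polar Q v w"
  using polar_mult_left [of "x + y" v w] polar_mult_left [of x v w] polar_mult_left [of y v w]
  by (simp add: mult_simps polar_simps Q_add algebra_simps)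

text \<open>The standard involution. Its usual factor 2 is absorbed by \<open>polar\<close>, which
  is twice the inner product, so \<open>polar Q x e\<close> is the trace of \<open>x\<close>; the
  negative of \<open>conjg\<close> is the reflection in the hyperplane orthogonal to
  \<open>e\<close>.\<close>

definition conjg :: "'a \<Rightarrow> 'a" where
  "conjg x = polar Q x e *\<^sub>R e - x"

lemma conjg_simps:
  "conjg (x + y) = conjg x + conjg y" "conjg (r *\<^sub>R x) = r *\<^sub>R conjg x" "conjg (- x) = - conjg x"
  "conjg (x - y) = conjg x - conjg y" "conjg 0 = 0"
  by (simp_all add: conjg_def polar_simps algebra_simps)

lemma conjg_conjg [simp]: "conjg (conjg x) = x"
  by (simp add: conjg_def polar_simps polar_self [OF quadratic] Q_unit)

lemma Q_conjg [simp]: "Q (conjg x) = Q x"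
  by (simp add: conjg_def Q_diff Q_scale Q_unit polar_simps polar_commute [of Q e x] power2_eq_square)

lemma polar_conjg: "polar Q (conjg x) y = polar Q x (conjg y)"
  by (metis Q_conjg conjg_conjg conjg_simps(1) polar_def)

lemma polar_mult_adjoint: "polar Q (x \<cdot> v) w = polar Q v (conjg x \<cdot> w)"
  using polar_mult_left_add [of x v e w] by (simp add: conjg_def mult_simps polar_simps)

text \<open>This is left alternativity in disguise: left multiplication by \<open>x\<close> scales
  the form by \<open>Q x\<close> and has left multiplication by \<open>conjg x\<close> as its
  adjoint. Together with its polarization \<open>mult_conjg_add\<close> it replaces associativity in
  everything that follows.\<close>

lemma conjg_mult_cancel: "conjg x \<cdot> (x \<cdot> v) = Q x *\<^sub>R v"
  by (rule polar_eqI)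
    (metis polar_mult_adjoint conjg_conjg polar_mult_left bilinear_lmul [OF bilinear_polar] real_scaleR_def)

lemma mult_conjg_cancel: "x \<cdot> (conjg x \<cdot> v) = Q x *\<^sub>R v"
  using conjg_mult_cancel [of "conjg x" v] by simp

lemma mult_conjg_add: "x \<cdot> (conjg y \<cdot> v) + y \<cdot> (conjg x \<cdot> v) = polar Q x y *\<^sub>R v"
  using mult_conjg_cancel [of "x + y" v] mult_conjg_cancel [of x v] mult_conjg_cancel [of y v]
  by (simp add: mult_simps conjg_simps Q_add algebra_simps)

section \<open>Elementary matrices and the group they generate\<close>

definition upper :: "'a \<Rightarrow> 'a ^ 2 \<Rightarrow> 'a ^ 2" where
  "upper a u = pair_vec (u $ 1 + a \<cdot> u $ 2) (u $ 2)"

definition lower :: "'a \<Rightarrow> 'a ^ 2 \<Rightarrow> 'a ^ 2" where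
  "lower a u = pair_vec (u $ 1) (u $ 2 + a \<cdot> u $ 1)"

text \<open>Real entries are enough for the elimination in \<open>herm_op_det\<close>, where the
  pivots are diagonal entries of Hermitian matrices.\<close>

definition diag :: "real \<Rightarrow> real \<Rightarrow> 'a ^ 2 \<Rightarrow> 'a ^ 2" where
  "diag r s u = pair_vec (r *\<^sub>R u $ 1) (s *\<^sub>R u $ 2)"

lemma upper_upper: "upper a \<circ> upper b = upper (a + b)"
  and lower_lower: "lower a \<circ> lower b = lower (a + b)"
  and upper_zero: "upper 0 = id" and lower_zero: "lower 0 = id"
  by (auto simp: fun_eq_iff upper_def lower_def pair_vec_eq_iff mult_simps)

lemma SL_generators:
  "{left_mult_map cmul (identity_matrix e + unit_matrix a i j) | a i j. (i::2) \<noteq> j} = range upper \<union> range lower"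
    (is "?L = _")
proof -
  have 1: "left_mult_map cmul (identity_matrix e + unit_matrix a (1::2) 2) = upper a" for a
    by (simp add: fun_eq_iff left_mult_map_def identity_matrix_def unit_matrix_def sum_2 upper_def
        pair_vec_eq_iff mult_simps)
  have 2: "left_mult_map cmul (identity_matrix e + unit_matrix a (2::2) 1) = lower a" for a
    by (simp add: fun_eq_iff left_mult_map_def identity_matrix_def unit_matrix_def sum_2 lower_def
        pair_vec_eq_iff mult_simps add.commute)
  define F where "F a i j = left_mult_map cmul (identity_matrix e + unit_matrix a i j)" for a and i j :: 2
  have "i \<noteq> j \<longleftrightarrow> i = 1 \<and> j = 2 \<or> i = 2 \<and> j = 1" for i j :: 2
    using exhaust_2 [of i] exhaust_2 [of j] by auto
  then have "{F a i j | a i j. i \<noteq> j} = range (\<lambda>a. F a 1 2) \<union> range (\<lambda>a. F a 2 1)"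
    by auto
  then show ?thesis by (simp only: F_def 1 2)
qed

abbreviation SL2 :: "('a ^ 2 \<Rightarrow> 'a ^ 2) set" where
  "SL2 \<equiv> carrier (SL cmul e)"

lemma SL2_eq: "SL2 = generate (BijGroup UNIV) (range upper \<union> range lower)"
  by (simp add: SL_def SL_generators)

lemma SL_generators_bij: "range upper \<union> range lower \<subseteq> carrier (BijGroup UNIV)"
proof -
  have "bij (upper a)" "bij (lower a)" for a
    using upper_upper [of a "- a"] upper_upper [of "- a" a] lower_lower [of a "- a"] lower_lower [of "- a" a]
    by (auto intro: o_bij simp: upper_zero lower_zero)
  then show ?thesis by (auto simp: BijGroup_def Bij_def)
qed

lemma BijGroup_UNIV_mult:
  "f \<in> carrier (BijGroup UNIV) \<Longrightarrow> g \<in> carrier (BijGroup UNIV) \<Longrightarrow> f \<otimes>\<^bsub>BijGroup UNIV\<^esub> g = f \<circ> g"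
  by (auto simp: BijGroup_def compose_def fun_eq_iff)

lemma SL2_bij: "SL2 \<subseteq> carrier (BijGroup UNIV)"
  unfolding SL2_eq by (rule group.generate_incl [OF group_BijGroup SL_generators_bij])

lemma SL2_comp [intro]: "f \<in> SL2 \<Longrightarrow> g \<in> SL2 \<Longrightarrow> f \<circ> g \<in> SL2"
  using generate.eng [of f "BijGroup UNIV" "range upper \<union> range lower" g] SL2_bij
    BijGroup_UNIV_mult [of f g] unfolding SL2_eq subset_iff by metis

lemma SL2_upper [intro]: "upper a \<in> SL2" and SL2_lower [intro]: "lower a \<in> SL2"
  unfolding SL2_eq by (auto intro: generate.incl)

lemma SL2_id [intro]: "id \<in> SL2"
  using SL2_upper [of 0] by (simp add: upper_zero)

text \<open>The inverse of a generator is the generator with the opposite parameter, so the inverse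
  case of \<open>generate\<close> disappears.\<close>

lemma SL2_induct [consumes 1, case_names id upper lower comp]:
  assumes "f \<in> SL2" and "P id" and "\<And>a. P (upper a)" "\<And>a. P (lower a)"
    and "\<And>f g. f \<in> SL2 \<Longrightarrow> g \<in> SL2 \<Longrightarrow> P f \<Longrightarrow> P g \<Longrightarrow> P (f \<circ> g)"
  shows "P f"
  using assms(1) unfolding SL2_eq
proof (induction rule: generate.induct)
  case one
  have "\<one>\<^bsub>BijGroup UNIV\<^esub> = (id :: 'a ^ 2 \<Rightarrow> 'a ^ 2)" by (auto simp: BijGroup_def)
  then show ?case using assms(2) by (simp only:)
next
  case (incl h)
  then show ?case using assms(3,4) by auto
next
  case (inv h)
  have one: "\<one>\<^bsub>BijGroup UNIV\<^esub> = (id :: 'a ^ 2 \<Rightarrow> 'a ^ 2)" by (auto simp: BijGroup_def)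
  obtain k where k: "k \<in> range upper \<union> range lower" "k \<circ> h = id"
    using inv upper_upper [of "- _"] lower_lower [of "- _"]
    by (auto simp: upper_zero lower_zero) (metis UnI1 UnI2 add.left_inverse rangeI upper_upper lower_lower upper_zero lower_zero)+
  have "inv\<^bsub>BijGroup UNIV\<^esub> h = k"
    using k inv SL_generators_bij
    by (intro group.inv_equality [OF group_BijGroup]) (auto simp: BijGroup_UNIV_mult one subset_iff)
  then show ?case using k assms(3,4) by auto
next
  case (eng h1 h2)
  then show ?case
    using assms(5) [of h1 h2] BijGroup_UNIV_mult [of h1 h2] SL2_bij unfolding SL2_eq subset_iff by metis
qed

text \<open>\<open>w r\<close> is the antidiagonal Weyl element written with three elementary
  matrices; a product of two of them is diagonal.\<close>

lemma SL2_diag: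
  assumes "r \<noteq> 0"
  shows "diag r (1 / r) \<in> SL2"
proof -
  define w where "w r = upper (r *\<^sub>R e) \<circ> (lower ((- 1 / r) *\<^sub>R e) \<circ> upper (r *\<^sub>R e))" for r
  have "w r u = pair_vec (r *\<^sub>R u $ 2) ((- 1 / r) *\<^sub>R u $ 1)" if "r \<noteq> 0" for r u
    using that by (simp add: w_def upper_def lower_def pair_vec_eq_iff mult_simps algebra_simps)
  then have "diag r (1 / r) = w r \<circ> w (- 1)"
    using assms by (simp add: fun_eq_iff diag_def)
  moreover have "w r \<in> SL2" for r unfolding w_def by blast
  ultimately show ?thesis by (simp only: SL2_comp)
qed

text \<open>\<open>\<delta>\<close> plays the role of a determinant in the group generated by \<open>SL2\<close> and \<open>diag (-1) 1\<close>.\<close>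

definition SL2_det :: "real \<Rightarrow> ('a ^ 2 \<Rightarrow> 'a ^ 2) \<Rightarrow> bool" where
  "SL2_det \<delta> f \<longleftrightarrow> \<delta> = 1 \<and> f \<in> SL2 \<or> \<delta> = -1 \<and> diag (-1) 1 \<circ> f \<in> SL2"

lemma diag_involution: "diag (-1) 1 \<circ> diag (-1) 1 = id"
  by (simp add: fun_eq_iff diag_def pair_vec_eq_iff)

text \<open>Conjugation by \<open>diag (-1) 1\<close> replaces the parameter of each generator by
  its negative, and conjugation respects products.\<close>

lemma SL2_conj_diag:
  assumes "f \<in> SL2"
  shows "diag (-1) 1 \<circ> f \<circ> diag (-1) 1 \<in> SL2"
  using assms
proof (induction rule: SL2_induct)
  case id
  show ?case using SL2_id by (simp only: comp_id diag_involution)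
next
  case (upper a)
  have "diag (-1) 1 \<circ> upper a \<circ> diag (-1) 1 = upper (- a)"
    by (simp add: fun_eq_iff diag_def upper_def pair_vec_eq_iff mult_simps)
  then show ?case by (simp only: SL2_upper)
next
  case (lower a)
  have "diag (-1) 1 \<circ> lower a \<circ> diag (-1) 1 = lower (- a)"
    by (simp add: fun_eq_iff diag_def lower_def pair_vec_eq_iff mult_simps)
  then show ?case by (simp only: SL2_lower)
next
  case (comp f g)
  have "diag (-1) 1 \<circ> (f \<circ> g) \<circ> diag (-1) 1 =
      (diag (-1) 1 \<circ> f) \<circ> (diag (-1) 1 \<circ> diag (-1) 1) \<circ> (g \<circ> diag (-1) 1)"
    by (simp only: diag_involution comp_assoc id_comp)
  also have "\<dots> = (diag (-1) 1 \<circ> f \<circ> diag (-1) 1) \<circ> (diag (-1) 1 \<circ> g \<circ> diag (-1) 1)"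
    by (simp only: comp_assoc)
  finally show ?case using SL2_comp [OF comp(3,4)] by (simp only:)
qed

lemma SL2_det_comp:
  assumes "SL2_det \<delta> f" "SL2_det \<eta> g"
  shows "SL2_det (\<delta> * \<eta>) (f \<circ> g)"
proof -
  let ?W = "diag (-1) 1"
  have WW: "?W \<circ> (?W \<circ> h) = h" for h :: "'a ^ 2 \<Rightarrow> 'a ^ 2"
    using diag_involution by (simp only: comp_assoc [symmetric] id_comp)
  \<comment> \<open>Inserting \<open>?W \<circ> ?W = id\<close> between \<open>f\<close> and
    \<open>g\<close> moves the reflection to the right factor, and the left factor becomes a
    conjugate covered by \<open>SL2_conj_diag\<close>.\<close>
  have eq1: "?W \<circ> (f \<circ> g) = (?W \<circ> f \<circ> ?W) \<circ> (?W \<circ> g)" by (simp only: comp_assoc WW)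
  have eq2: "f \<circ> g = (?W \<circ> (?W \<circ> f) \<circ> ?W) \<circ> (?W \<circ> g)" by (simp only: comp_assoc WW)
  consider "\<delta> = 1" "f \<in> SL2" "\<eta> = 1" "g \<in> SL2" | "\<delta> = -1" "?W \<circ> f \<in> SL2" "\<eta> = 1" "g \<in> SL2"
    | "\<delta> = 1" "f \<in> SL2" "\<eta> = -1" "?W \<circ> g \<in> SL2" | "\<delta> = -1" "?W \<circ> f \<in> SL2" "\<eta> = -1" "?W \<circ> g \<in> SL2"
    using assms unfolding SL2_det_def by blast
  then show ?thesis
  proof cases
    case 1
    then show ?thesis using SL2_comp [of f g] by (simp only: SL2_det_def mult_1 simp_thms)
  next
    case 2
    then have "(?W \<circ> f) \<circ> g \<in> SL2" by blast
    then show ?thesis using 2 by (simp only: SL2_det_def comp_assoc mult_1_right simp_thms)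
  next
    case 3
    have "?W \<circ> (f \<circ> g) \<in> SL2"
      unfolding eq1 by (rule SL2_comp [OF SL2_conj_diag [OF 3(2)] 3(4)])
    then show ?thesis using 3 by (simp only: SL2_det_def mult_1 simp_thms)
  next
    case 4
    have "f \<circ> g \<in> SL2"
      by (subst eq2) (rule SL2_comp [OF SL2_conj_diag [OF 4(2)] 4(4)])
    moreover have "\<delta> * \<eta> = 1" using 4 by simp
    ultimately show ?thesis by (simp only: SL2_det_def simp_thms)
  qed
qed

text \<open>Minus the identity is \<open>diag (-1) (-1)\<close>, which lies in \<open>SL2\<close>.
  This absorbs the minus sign in the second component of the Clifford action.\<close>

lemma SL2_det_uminus:
  assumes "SL2_det \<delta> f"
  shows "SL2_det \<delta> (\<lambda>u. - f u)"
proof -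
  have "SL2_det 1 (diag (-1) (-1))" using SL2_diag [of "-1"] by (simp add: SL2_det_def)
  from SL2_det_comp [OF this assms] have "SL2_det \<delta> (diag (-1) (-1) \<circ> f)" by simp
  also have "diag (-1) (-1) \<circ> f = (\<lambda>u. - f u)" by (simp add: fun_eq_iff diag_def pair_vec_eq_iff)
  finally show ?thesis .
qed

text \<open>\<open>(s, x, t)\<close> stands for the Hermitian matrix with diagonal \<open>s, t\<close> and upper right entry \<open>x\<close>;
  \<open>herm_form\<close> is minus its determinant and \<open>herm_adj\<close> its adjugate.\<close>

definition herm_op :: "real \<times> 'a \<times> real \<Rightarrow> 'a ^ 2 \<Rightarrow> 'a ^ 2" where
  "herm_op = (\<lambda>(s, x, t) u. pair_vec (s *\<^sub>R u $ 1 + x \<cdot> u $ 2) (conjg x \<cdot> u $ 1 + t *\<^sub>R u $ 2))"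

definition herm_form :: "real \<times> 'a \<times> real \<Rightarrow> real" where
  "herm_form = (\<lambda>(s, x, t). Q x - s * t)"

definition herm_adj :: "real \<times> 'a \<times> real \<Rightarrow> real \<times> 'a \<times> real" where
  "herm_adj = (\<lambda>(s, x, t). (t, - x, s))"

lemma herm_form_adj [simp]: "herm_form (herm_adj X) = herm_form X"
  by (cases X) (simp add: herm_form_def herm_adj_def Q_minus)

lemma herm_adj_adj [simp]: "herm_adj (herm_adj X) = X"
  by (cases X) (simp add: herm_adj_def)

lemma herm_op_adj: "herm_op X (herm_op (herm_adj X) u) = - herm_form X *\<^sub>R u"
proof (cases X)
  case (fields s x t)
  then show ?thesis
    using mult_conjg_cancel [of x "u $ 1"] conjg_mult_cancel [of x "u $ 2"]
    by (simp add: herm_op_def herm_adj_def herm_form_def pair_vec_eq_iff mult_simps conjg_simps algebra_simps)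
qed

lemma herm_op_linear: "linear (herm_op X)"
  by (cases X, rule linearI) (simp_all add: herm_op_def pair_vec_eq_iff mult_simps algebra_simps)

text \<open>Gaussian elimination with pivot \<open>t\<close>; if \<open>t = 0\<close>, a congruence by a lower elementary matrix
  first makes the pivot nonzero.\<close>

lemma herm_op_det:
  assumes "\<bar>herm_form X\<bar> = 1"
  shows "SL2_det (- herm_form X) (herm_op X)"
proof -
  have elem: "SL2_det 1 (upper a)" "SL2_det 1 (lower a)" for a by (auto simp: SL2_det_def)
  have pivot: "SL2_det (- herm_form (s, x, t)) (herm_op (s, x, t))"
    if "\<bar>herm_form (s, x, t)\<bar> = 1" "t \<noteq> 0" for s x t
  proof -
    define \<delta> where "\<delta> = - herm_form (s, x, t)"
    have \<delta>: "\<delta> = 1 \<or> \<delta> = -1" "s = (\<delta> + Q x) / t"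
      using that by (auto simp: \<delta>_def herm_form_def field_simps)
    \<comment> \<open>The factorization with pivot \<open>t\<close>; the corner entry is matched by
      \<open>s = (\<delta> + Q x) / t\<close> and \<open>mult_conjg_cancel\<close>.\<close>
    have "herm_op (s, x, t) = upper ((1 / t) *\<^sub>R x) \<circ> (diag (\<delta> / t) t \<circ> lower ((1 / t) *\<^sub>R conjg x))"
      using \<open>t \<noteq> 0\<close> mult_conjg_cancel [of x]
      by (simp add: fun_eq_iff herm_op_def upper_def lower_def diag_def pair_vec_eq_iff mult_simps
          \<delta>(2) algebra_simps add_divide_distrib)
    moreover have "SL2_det \<delta> (diag (\<delta> / t) t)"
    proof -
      have "diag (1 / t) t \<in> SL2" using SL2_diag [of "1 / t"] \<open>t \<noteq> 0\<close> by simp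
      moreover have "diag (-1) 1 \<circ> diag (- 1 / t) t = diag (1 / t) t"
        by (simp add: fun_eq_iff diag_def)
      ultimately show ?thesis using \<delta>(1) by (auto simp: SL2_det_def)
    qed
    ultimately have "SL2_det (1 * (\<delta> * 1)) (herm_op (s, x, t))"
      by (metis SL2_det_comp elem)
    then show ?thesis by (simp add: \<delta>_def)
  qed
  obtain s x t where X: "X = (s, x, t)" by (cases X)
  show ?thesis
  proof (cases "t = 0")
    case False
    then show ?thesis using pivot assms X by simp
  next
    case True
    \<comment> \<open>The new pivot will be \<open>r * Q x * (2 + s * r)\<close>; the sign
      \<open>r\<close> is chosen so that the last factor is nonzero.\<close>
    define r :: real where "r = (if s = -2 then -1 else 1)"
    define b where "b = r *\<^sub>R conjg x"
    define t' where "t' = polar Q b (conjg x) + s * Q b"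
    define X' where "X' = (s, x + s *\<^sub>R conjg b, t')"
    have Qx: "Q x \<noteq> 0" using assms True X by (auto simp: herm_form_def)
    have "t' = r * Q x * (2 + s * r)"
      by (simp add: t'_def b_def polar_simps polar_self [OF quadratic] Q_scale power2_eq_square algebra_simps)
    then have t': "t' \<noteq> 0" using Qx by (auto simp: r_def)
    have "polar Q b (conjg x) = polar Q x (conjg b)" by (simp add: polar_conjg polar_commute [of Q b])
    then have form: "herm_form X' = herm_form X"
      using True by (simp add: X X'_def herm_form_def t'_def Q_add Q_scale polar_simps power2_eq_square algebra_simps)
    \<comment> \<open>A congruence of operators: the products that would need associativity occur
      only in the combination evaluated by \<open>mult_conjg_add\<close>.\<close>
    have "lower b (herm_op X (upper (conjg b) u)) = herm_op X' u" for u
      using True mult_conjg_add [of b "conjg x" "u $ 2"] mult_conjg_cancel [of b "u $ 2"]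
      by (simp add: X X'_def t'_def herm_op_def lower_def upper_def pair_vec_eq_iff mult_simps conjg_simps algebra_simps)
    moreover have "upper (conjg b) (upper (- conjg b) u) = u" "lower (- b) (lower b u) = u" for u
      using upper_upper [of "conjg b" "- conjg b"] lower_lower [of "- b" b]
      by (simp_all add: fun_eq_iff upper_zero lower_zero)
    ultimately have "herm_op X = lower (- b) \<circ> (herm_op X' \<circ> upper (- conjg b))"
      unfolding fun_eq_iff o_def by metis
    moreover have "SL2_det (- herm_form X) (herm_op X')"
      using pivot [of s "x + s *\<^sub>R conjg b" t'] assms t' form by (simp add: X'_def)
    ultimately have "SL2_det (1 * (- herm_form X * 1)) (herm_op X)"
      by (metis SL2_det_comp elem)
    then show ?thesis by simp
  qed
qed

text \<open>The orthogonal sum of two copies of the polar form. It serves as the duality between the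
  two half-spin spaces, see \<open>chiral_form\<close>.\<close>

definition pair_form :: "'a ^ 2 \<Rightarrow> 'a ^ 2 \<Rightarrow> real" where
  "pair_form u w = polar Q (u $ 1) (w $ 1) + polar Q (u $ 2) (w $ 2)"

lemma bilinear_pair_form: "bilinear pair_form"
  unfolding bilinear_def
  by (auto intro!: linearI simp: pair_form_def polar_simps algebra_simps)

lemmas pair_form_simps =
  bilinear_ladd [OF bilinear_pair_form] bilinear_radd [OF bilinear_pair_form]
  bilinear_lmul [OF bilinear_pair_form] bilinear_rmul [OF bilinear_pair_form]
  bilinear_lneg [OF bilinear_pair_form] bilinear_rneg [OF bilinear_pair_form]

lemma pair_form_commute: "pair_form u w = pair_form w u"
  by (simp add: pair_form_def polar_commute)

lemma pair_form_eqI: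
  assumes "\<And>u. pair_form u v = pair_form u w"
  shows "v = w"
proof -
  have "polar Q (v $ 1) x = polar Q (w $ 1) x" "polar Q (v $ 2) x = polar Q (w $ 2) x" for x
    using assms [of "pair_vec x 0"] assms [of "pair_vec 0 x"]
    by (simp_all add: pair_form_def polar_simps polar_commute [of Q x])
  then show ?thesis by (auto simp: pair_vec_eq_iff intro: polar_eqI)
qed

lemma herm_op_self_adjoint: "pair_form (herm_op X u) w = pair_form u (herm_op X w)"
  by (cases X) (simp add: pair_form_def herm_op_def polar_simps polar_mult_adjoint)

text \<open>With \<open>M\<close> the Gram operator of \<open>pair_form\<close> relative to the
  inner product and \<open>N\<close> its inverse, the adjoint is \<open>N\<close> after the
  Euclidean adjoint after \<open>M\<close>. Its linearity in \<open>T\<close> is what smoothness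
  requires later.\<close>

lemma pair_form_adjoint:
  obtains R :: "(('a ^ 2) \<Rightarrow>\<^sub>L ('a ^ 2)) \<Rightarrow> (('a ^ 2) \<Rightarrow>\<^sub>L ('a ^ 2))"
  where "linear R" "\<And>(T :: ('a ^ 2) \<Rightarrow>\<^sub>L ('a ^ 2)) u w. pair_form (blinfun_apply T u) w = pair_form u (blinfun_apply (R T) w)"
proof -
  define M where "M w = (\<Sum>b\<in>Basis. pair_form b w *\<^sub>R b)" for w
  have linM: "linear M"
    unfolding M_def by (rule linearI) (simp_all add: pair_form_simps scaleR_left_distrib sum.distrib scaleR_sum_right)
  have M: "u \<bullet> M w = pair_form u w" for u w
  proof -
    have l: "linear (\<lambda>u. pair_form u w)" using bilinear_pair_form by (simp add: bilinear_def)
    have "pair_form u w = pair_form (\<Sum>b\<in>Basis. (u \<bullet> b) *\<^sub>R b) w"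
      by (simp only: euclidean_representation)
    also have "\<dots> = (\<Sum>b\<in>Basis. (u \<bullet> b) * pair_form b w)"
      by (simp only: linear_sum [OF l] linear_cmul [OF l] real_scaleR_def)
    finally have "pair_form u w = (\<Sum>b\<in>Basis. (u \<bullet> b) * pair_form b w)" .
    then show ?thesis by (simp add: M_def inner_sum_right mult.commute)
  qed
  have "inj M"
    by (rule injI) (metis M pair_form_eqI)
  then obtain N where N: "linear N" "\<And>x. N (M x) = x" "\<And>x. M (N x) = x"
    using linear_injective_isomorphism [OF linM] by blast
  define R where "R T = Blinfun (\<lambda>w. N (adjoint (blinfun_apply T) (M w)))" for T :: "('a ^ 2) \<Rightarrow>\<^sub>L ('a ^ 2)"
  have R: "pair_form (blinfun_apply T u) w = pair_form u (R T w)" for T u w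
  proof -
    have lin: "linear (blinfun_apply T)" by (rule bounded_linear.linear) (rule blinfun.bounded_linear_right)
    have "linear (\<lambda>w. N (adjoint (blinfun_apply T) (M w)))"
      using linear_compose [OF linear_compose [OF linM adjoint_linear [OF lin]] N(1)] by (simp add: o_def)
    then have "R T w = N (adjoint (blinfun_apply T) (M w))"
      by (simp add: R_def bounded_linear_Blinfun_apply linear_conv_bounded_linear)
    then show ?thesis
      using adjoint_works [OF lin, of u "M w"] by (simp flip: M add: N)
  qed
  have "R (S + T) w = R S w + R T w" "R (c *\<^sub>R T) w = c *\<^sub>R R T w" for S T c w
    by (rule pair_form_eqI, simp add: R [symmetric] blinfun.add_left blinfun.scaleR_left pair_form_simps)+
  then have "linear R"
    by (intro linearI blinfun_eqI) (simp_all add: blinfun.add_left blinfun.scaleR_left)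
  then show ?thesis using that R by blast
qed

end

section \<open>The half-spin representation\<close>

lemma quadratic_form_orthogonal_sum:
  assumes "quadratic_form q" "finite I" "\<And>i j. i \<in> I \<Longrightarrow> j \<in> I \<Longrightarrow> i \<noteq> j \<Longrightarrow> polar q (f i) (f j) = 0"
  shows "q (\<Sum>i\<in>I. c i *\<^sub>R f i) = (\<Sum>i\<in>I. (c i)\<^sup>2 * q (f i))"
  using assms(2,3)
proof (induction I rule: finite_induct)
  case empty
  have "q (0 *\<^sub>R 0) = 0\<^sup>2 * q 0" using assms(1) by (simp only: quadratic_form_def)
  then show ?case by simp
next
  case (insert i I)
  have bil: "bilinear (polar q)" using assms(1) by (simp add: quadratic_form_def)
  then have l: "linear (polar q (c i *\<^sub>R f i))" by (simp add: bilinear_def)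
  have "polar q (c i *\<^sub>R f i) (c j *\<^sub>R f j) = 0" if "j \<in> I" for j
    using insert.hyps insert.prems [of i j] that
    by (auto simp: bilinear_lmul [OF bil] bilinear_rmul [OF bil])
  then have "polar q (c i *\<^sub>R f i) (\<Sum>j\<in>I. c j *\<^sub>R f j) = 0"
    unfolding linear_sum [OF l] by (intro sum.neutral) blast
  then have "q (c i *\<^sub>R f i + (\<Sum>j\<in>I. c j *\<^sub>R f j)) = q (c i *\<^sub>R f i) + q (\<Sum>j\<in>I. c j *\<^sub>R f j)"
    by (simp add: polar_def)
  moreover have "q (c i *\<^sub>R f i) = (c i)\<^sup>2 * q (f i)" using assms(1) by (simp add: quadratic_form_def)
  ultimately show ?case using insert by simp
qed

text \<open>The rank function is injective with values below the cardinality, hence a bijection onto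
  an initial segment. The lemma counts the positive coordinates of
  \<open>standard_sign\<close>.\<close>

lemma card_rank_less:
  assumes "m \<le> CARD('n::{finite,linorder})"
  shows "card {i::'n. card {j. j < i} < m} = m"
proof -
  define r where "r i = card {j. j < i}" for i :: 'n
  have less: "r i < r j" if "i < j" for i j
    unfolding r_def using that by (intro psubset_card_mono) auto
  then have "inj r" by (auto intro!: linorder_injI simp: less_imp_neq)
  moreover have "r i < CARD('n)" for i
    unfolding r_def by (intro psubset_card_mono) auto
  then have "range r \<subseteq> {..<CARD('n)}" by auto
  ultimately have "range r = {..<CARD('n)}"
    by (intro card_subset_eq) (auto simp: card_image)
  then have "r ` {i. r i < m} = {..<m}"
    using assms by (auto simp: image_iff set_eq_iff) (metis lessThan_iff less_le_trans rangeE)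
  then have "card {i. r i < m} = card {..<m}"
    using \<open>inj r\<close> by (metis card_image inj_on_subset subset_UNIV)
  then show ?thesis by (simp add: r_def)
qed

context composition_algebra
begin

lemma polar_herm_form:
  "polar herm_form (s, x, t) (s', x', t') = polar Q x x' - s * t' - t * s'"
  by (simp add: polar_def herm_form_def algebra_simps)

lemma quadratic_herm_form: "quadratic_form herm_form"
  unfolding quadratic_form_def bilinear_def
proof (intro conjI allI)
  fix r :: real and X :: "real \<times> 'a \<times> real"
  show "herm_form (r *\<^sub>R X) = r\<^sup>2 * herm_form X"
    by (cases X) (simp add: herm_form_def Q_scale power2_eq_square algebra_simps)
  show "linear (polar herm_form X)"
    by (cases X, rule linearI) (auto simp: polar_herm_form polar_simps algebra_simps)
  show "linear (\<lambda>Y. polar herm_form Y X)"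
    by (cases X, rule linearI) (auto simp: polar_herm_form polar_simps algebra_simps)
qed

text \<open>A normalized orthogonal basis of the algebra supplies \<open>p\<close> positive and
  \<open>q\<close> negative vectors, and the diagonal matrices form a hyperbolic plane that supplies
  one more of each sign. Ranks decide which index gets which vector.\<close>

lemma hermitian_frame_exists:
  assumes "has_signature Q p q" and card_n: "CARD('n::{finite,linorder}) = p + q + 2"
  obtains f :: "'n::{finite,linorder} \<Rightarrow> real \<times> 'a \<times> real"
  where "\<And>v. herm_form (\<Sum>i\<in>UNIV. v $ i *\<^sub>R f i) = diagonal_form (standard_sign (p + 1) (q + 1)) v"
    and "\<And>X. \<exists>v. (\<Sum>i\<in>UNIV. v $ i *\<^sub>R f i) = X"
proof -
  obtain B where B: "finite B" "independent B" "span B = UNIV"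
    and orth: "\<And>x y. x \<in> B \<Longrightarrow> y \<in> B \<Longrightarrow> x \<noteq> y \<Longrightarrow> polar Q x y = 0"
    and cards: "card {x \<in> B. Q x > 0} = p" "card {x \<in> B. Q x < 0} = q"
    using assms(1) unfolding has_signature_def by blast
  \<comment> \<open>A basis vector with \<open>Q b = 0\<close> would be orthogonal to the whole
    basis, itself included.\<close>
  have Q_nonzero: "Q b \<noteq> 0" if "b \<in> B" for b
  proof
    assume "Q b = 0"
    then have "polar Q b b = 0" by (simp add: polar_self [OF quadratic])
    then have "polar Q b y = 0" if "y \<in> B" for y
      using orth [OF \<open>b \<in> B\<close> that] by (cases "y = b") auto
    then have "polar Q b y = 0" for y
      using linear_eq_0_on_span [of "polar Q b" B y] bilinear_polar B(3) by (auto simp: bilinear_def)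
    then have "b = 0" by (intro polar_eqI) (simp add: polar_simps)
    then show False using B(2) that dependent_zero by blast
  qed
  define \<epsilon> :: "'n \<Rightarrow> real" where "\<epsilon> = standard_sign (p + 1) (q + 1)"
  define P where "P = {i::'n. card {j. j < i} < p + 1}"
  \<comment> \<open>All ranks lie below \<open>p + q + 2\<close>, so the default value 0 of
    \<open>standard_sign\<close> does not occur.\<close>
  have "card {j. j < i} < p + q + 2" for i :: 'n
    unfolding card_n [symmetric] by (intro psubset_card_mono) auto
  then have \<epsilon>: "\<epsilon> i = (if i \<in> P then 1 else -1)" for i
    by (simp add: \<epsilon>_def standard_sign_def P_def)
  have card_P: "card P = p + 1" unfolding P_def by (rule card_rank_less) (simp add: card_n)
  then have card_N: "card (- P) = q + 1" using card_Diff_subset [of P UNIV] by (simp add: Compl_eq_Diff_UNIV card_n)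
  obtain k where k: "k \<in> P" using card_P by (metis card.empty equals0I add_is_0 one_neq_zero)
  obtain l where l: "l \<in> - P" using card_N by (metis card.empty equals0I add_is_0 one_neq_zero)
  have "card (P - {k}) = card {x \<in> B. Q x > 0}" "card (- P - {l}) = card {x \<in> B. Q x < 0}"
    using k l card_P card_N cards by simp_all
  then obtain hP hN where hP: "bij_betw hP (P - {k}) {x \<in> B. Q x > 0}"
    and hN: "bij_betw hN (- P - {l}) {x \<in> B. Q x < 0}"
    using finite_same_card_bij [of "P - {k}" "{x \<in> B. Q x > 0}"]
      finite_same_card_bij [of "- P - {l}" "{x \<in> B. Q x < 0}"] B(1) by auto
  define h where "h i = (if i \<in> P then hP i else hN i)" for i
  have h_B: "h i \<in> B" "sgn (Q (h i)) = \<epsilon> i" if "i \<noteq> k" "i \<noteq> l" for i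
    using that bij_betwE [OF hP] bij_betwE [OF hN] by (auto simp: h_def \<epsilon>)
  have h_inj: "h i \<noteq> h j" if "i \<noteq> j" "i \<notin> {k, l}" "j \<notin> {k, l}" for i j
  proof (cases "i \<in> P \<longleftrightarrow> j \<in> P")
    case True
    then show ?thesis
      using that inj_onD [OF bij_betw_imp_inj_on [OF hP], of i j] inj_onD [OF bij_betw_imp_inj_on [OF hN], of i j]
      by (auto simp: h_def)
  next
    case False
    then have "\<epsilon> i \<noteq> \<epsilon> j" by (auto simp: \<epsilon>)
    then show ?thesis using that h_B(2) [of i] h_B(2) [of j] by auto
  qed
  have h_surj: "\<exists>i. i \<noteq> k \<and> i \<noteq> l \<and> h i = b" if b: "b \<in> B" for b
  proof (cases "Q b > 0")
    case True
    then have "b \<in> hP ` (P - {k})" using b bij_betw_imp_surj_on [OF hP] by simp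
    then show ?thesis using l by (auto simp: h_def)
  next
    case False
    then have "b \<in> hN ` (- P - {l})"
      using b Q_nonzero [OF b] bij_betw_imp_surj_on [OF hN] by simp
    then show ?thesis using k by (auto simp: h_def)
  qed
  \<comment> \<open>The indices \<open>k\<close> and \<open>l\<close> are reserved for the
    hyperbolic plane: \<open>(1, 0, -1)\<close> has form 1 and \<open>(1, 0, 1)\<close> has form
    -1.\<close>
  define f :: "'n \<Rightarrow> real \<times> 'a \<times> real" where "f i = (if i = k then (1, 0, -1) else if i = l then (1, 0, 1)
      else (0, (1 / sqrt \<bar>Q (h i)\<bar>) *\<^sub>R h i, 0))" for i
  have "k \<noteq> l" using k l by auto
  have form: "herm_form (f i) = \<epsilon> i" for i
  proof -
    have "(1 / sqrt \<bar>Q b\<bar>)\<^sup>2 * Q b = sgn (Q b)" if "b \<in> B" for b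
      using Q_nonzero [OF that] by (simp add: power_divide sgn_if)
    then show ?thesis
      using h_B [of i] k l by (auto simp: f_def herm_form_def Q_scale \<epsilon>)
  qed
  have f_orth: "polar herm_form (f i) (f j) = 0" if "i \<noteq> j" for i j
    using that h_B(1) [of i] h_B(1) [of j] h_inj [of i j] orth [of "h i" "h j"]
    by (auto simp: f_def polar_herm_form polar_simps)
  define F where "F v = (\<Sum>i\<in>UNIV. v $ i *\<^sub>R f i)" for v :: "(real, 'n) vec"
  have "linear F"
    unfolding F_def by (rule linearI) (simp_all add: scaleR_left_distrib sum.distrib scaleR_sum_right)
  then have sub: "subspace (range F)" by (simp add: linear_subspace_image)
  have f_range: "f i \<in> range F" for i
  proof -
    have "F (axis i 1) = (\<Sum>j\<in>UNIV. if j = i then f i else 0)"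
      unfolding F_def by (rule sum.cong) (auto simp: axis_def)
    then have "F (axis i 1) = f i" by simp
    then show ?thesis by (rule range_eqI [OF sym])
  qed
  have mid: "(0, x, 0) \<in> range F" for x
  proof -
    have "x \<in> span B" using B(3) by simp
    then show ?thesis
    proof (induction rule: span_induct_alt)
      case base
      then show ?case using subspace_0 [OF sub] by (simp add: zero_prod_def)
    next
      case (step c b y)
      obtain i where i: "i \<noteq> k" "i \<noteq> l" "h i = b" using h_surj [OF step(1)] by blast
      then have "(0, c *\<^sub>R b, 0) = (c * sqrt \<bar>Q b\<bar>) *\<^sub>R f i"
        using Q_nonzero [OF step(1)] by (simp add: f_def)
      then have "(0, c *\<^sub>R b, 0) \<in> range F"
        using subspace_scale [OF sub f_range] by metis
      from subspace_add [OF sub this step(2)] show ?case by simp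
    qed
  qed
  have F_surj: "X \<in> range F" for X
  proof (cases X)
    case (fields s x t)
    have "X = ((s - t) / 2) *\<^sub>R f k + ((s + t) / 2) *\<^sub>R f l + (0, x, 0)"
      using \<open>k \<noteq> l\<close> by (simp add: fields f_def field_simps)
    then show ?thesis
      using subspace_add [OF sub subspace_add [OF sub subspace_scale [OF sub f_range] subspace_scale [OF sub f_range]] mid]
      by metis
  qed
  have surj: "\<exists>v. (\<Sum>i\<in>UNIV. v $ i *\<^sub>R f i) = X" for X
  proof -
    obtain v where "X = F v" using F_surj [of X] by blast
    then show ?thesis unfolding F_def by (intro exI [of _ v]) (rule sym)
  qed
  have "herm_form (\<Sum>i\<in>UNIV. v $ i *\<^sub>R f i) = diagonal_form \<epsilon> v" for v
    using quadratic_form_orthogonal_sum [OF quadratic_herm_form, of UNIV f "\<lambda>i. v $ i"] f_orth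
    by (simp add: form diagonal_form_def mult.commute)
  with surj show ?thesis using that unfolding \<epsilon>_def by blast
qed

end

section \<open>The Clifford action on two copies of C^2\<close>

locale hermitian_frame = composition_algebra cmul e Q
  for cmul :: "'a::euclidean_space \<Rightarrow> 'a \<Rightarrow> 'a" (infixl "\<cdot>" 70) and e :: 'a and Q :: "'a \<Rightarrow> real" +
  fixes \<epsilon> :: "'n::{finite,linorder} \<Rightarrow> real" and f :: "'n \<Rightarrow> real \<times> 'a \<times> real"
  assumes frame_form: "herm_form (\<Sum>i\<in>UNIV. v $ i *\<^sub>R f i) = diagonal_form \<epsilon> v"
    and frame_surj: "\<exists>v. (\<Sum>i\<in>UNIV. v $ i *\<^sub>R f i) = X"
    and sign_nonzero: "\<epsilon> i \<noteq> 0"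
begin

definition frame :: "(real, 'n) vec \<Rightarrow> real \<times> 'a \<times> real" where
  "frame v = (\<Sum>i\<in>UNIV. v $ i *\<^sub>R f i)"

lemma linear_frame: "linear frame"
  unfolding frame_def by (rule linearI) (simp_all add: scaleR_left_distrib sum.distrib scaleR_sum_right)

lemma herm_form_frame: "herm_form (frame v) = diagonal_form \<epsilon> v"
  by (simp add: frame_def frame_form)

lemma frame_axis: "frame (axis i 1) = f i"
proof -
  have "frame (axis i 1) = (\<Sum>j\<in>UNIV. if j = i then f i else 0)"
    unfolding frame_def by (rule sum.cong) (auto simp: axis_def)
  then show ?thesis by simp
qed

text \<open>The minus sign turns the identity \<open>herm_op_adj\<close>, whose right side is minus
  the form, into the convention that a vector squares to its form.\<close>

definition clifford_action :: "real \<times> 'a \<times> real \<Rightarrow> (('a ^ 2) \<times> ('a ^ 2)) \<Rightarrow>\<^sub>L (('a ^ 2) \<times> ('a ^ 2))" where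
  "clifford_action X = Blinfun (\<lambda>(u, w). (herm_op X w, - herm_op (herm_adj X) u))"

lemma clifford_action_apply: "clifford_action X (u, w) = (herm_op X w, - herm_op (herm_adj X) u)"
proof -
  have "linear (\<lambda>(u, w). (herm_op X w, - herm_op (herm_adj X) u))"
    by (rule linearI)
      (auto simp: linear_add [OF herm_op_linear] linear_cmul [OF herm_op_linear])
  then show ?thesis
    by (simp add: clifford_action_def bounded_linear_Blinfun_apply linear_conv_bounded_linear)
qed

lemma herm_op_add: "herm_op (X + Y) u = herm_op X u + herm_op Y u"
  by (cases X, cases Y) (simp add: herm_op_def pair_vec_eq_iff mult_simps conjg_simps algebra_simps)

lemma herm_op_scale: "herm_op (r *\<^sub>R X) u = r *\<^sub>R herm_op X u"
  by (cases X) (simp add: herm_op_def pair_vec_eq_iff mult_simps conjg_simps algebra_simps)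

lemma linear_clifford_action: "linear clifford_action"
proof (rule linearI)
  have adj: "herm_adj (X + Y) = herm_adj X + herm_adj Y" "herm_adj (r *\<^sub>R X) = r *\<^sub>R herm_adj X" for X Y r
    by (cases X, cases Y, simp add: herm_adj_def)+
  show "clifford_action (X + Y) = clifford_action X + clifford_action Y" for X Y
    by (rule blinfun_eqI) (auto simp: clifford_action_apply adj herm_op_add blinfun.add_left)
  show "clifford_action (r *\<^sub>R X) = r *\<^sub>R clifford_action X" for r X
    by (rule blinfun_eqI) (auto simp: clifford_action_apply adj herm_op_scale blinfun.scaleR_left)
qed

lemma clifford_action_square: "clifford_action X o\<^sub>L clifford_action X = herm_form X *\<^sub>R id_blinfun"
proof (rule blinfun_eqI)
  fix z
  show "(clifford_action X o\<^sub>L clifford_action X) z = (herm_form X *\<^sub>R id_blinfun) z"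
    using herm_op_adj [of X] herm_op_adj [of "herm_adj X"]
    by (cases z) (simp add: clifford_action_apply blinfun.scaleR_left linear_neg [OF herm_op_linear])
qed

definition grading :: "(('a ^ 2) \<times> ('a ^ 2)) \<Rightarrow>\<^sub>L (('a ^ 2) \<times> ('a ^ 2))" where
  "grading = Blinfun (\<lambda>(u, w). (u, - w))"

lemma grading_apply: "grading (u, w) = (u, - w)"
proof -
  have "linear (\<lambda>(u, w). (u :: 'a ^ 2, - w :: 'a ^ 2))"
    by (rule linearI) auto
  then show ?thesis
    by (simp add: grading_def bounded_linear_Blinfun_apply linear_conv_bounded_linear)
qed

sublocale graded_clifford_rep \<epsilon> "\<lambda>i. clifford_action (f i)" grading
proof
  show sq: "clifford_action (f i) o\<^sub>L clifford_action (f i) = \<epsilon> i *\<^sub>R id_blinfun" for i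
  proof -
    have "diagonal_form \<epsilon> (axis i 1) = (\<Sum>j\<in>UNIV. if j = i then \<epsilon> i else 0)"
      unfolding diagonal_form_def by (rule sum.cong) (auto simp: axis_def)
    then show ?thesis
      using herm_form_frame [of "axis i 1"] by (simp add: clifford_action_square frame_axis)
  qed
  show "clifford_action (f i) o\<^sub>L clifford_action (f j) = - (clifford_action (f j) o\<^sub>L clifford_action (f i))" if "i \<noteq> j" for i j
  proof -
    \<comment> \<open>Orthogonality of the frame is read off by polarization:
      \<open>f i + f j\<close> has form \<open>\<epsilon> i + \<epsilon> j\<close>, so the
      anticommutator vanishes.\<close>
    have "diagonal_form \<epsilon> (axis i 1 + axis j 1) =
        (\<Sum>k\<in>UNIV. (if k = i then \<epsilon> i else 0) + (if k = j then \<epsilon> j else 0))"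
      unfolding diagonal_form_def using that by (intro sum.cong) (auto simp: axis_def)
    also have "\<dots> = \<epsilon> i + \<epsilon> j" by (simp add: sum.distrib)
    finally have "herm_form (f i + f j) = \<epsilon> i + \<epsilon> j"
      using herm_form_frame [of "axis i 1 + axis j 1"] by (simp add: linear_add [OF linear_frame] frame_axis)
    then have "(clifford_action (f i) + clifford_action (f j)) o\<^sub>L (clifford_action (f i) + clifford_action (f j)) = (\<epsilon> i + \<epsilon> j) *\<^sub>R id_blinfun"
      using clifford_action_square [of "f i + f j"] by (simp add: linear_add [OF linear_clifford_action])
    then have "(clifford_action (f i) o\<^sub>L clifford_action (f j)) + (clifford_action (f j) o\<^sub>L clifford_action (f i)) = 0"
      by (simp add: blinfun_compose.add_left blinfun_compose.add_right sq scaleR_left_distrib add.commute)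
    then show ?thesis by (metis eq_neg_iff_add_eq_0)
  qed
  show "grading o\<^sub>L grading = id_blinfun"
    by (rule blinfun_eqI) (auto simp: grading_apply)
  show "grading o\<^sub>L clifford_action (f i) = - (clifford_action (f i) o\<^sub>L grading)" for i
    by (rule blinfun_eqI) (auto simp: grading_apply clifford_action_apply blinfun.minus_left linear_neg [OF herm_op_linear])
  show "\<epsilon> i \<noteq> 0" for i by (rule sign_nonzero)
qed

lemma rep_vec_frame: "rep (clifford_vec v) = clifford_action (frame v)"
  by (simp add: rep_vec frame_def linear_sum [OF linear_clifford_action] linear_cmul [OF linear_clifford_action])

text \<open>The two half-spin components of the action of a product of vectors, up to exchanging the
  source spaces when the number of factors is odd.\<close>

primrec chiral :: "(real \<times> 'a \<times> real) list \<Rightarrow> ('a ^ 2 \<Rightarrow> 'a ^ 2) \<times> ('a ^ 2 \<Rightarrow> 'a ^ 2)" where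
  "chiral [] = (id, id)"
| "chiral (X # Xs) = (herm_op X \<circ> snd (chiral Xs), (\<lambda>u. - herm_op (herm_adj X) u) \<circ> fst (chiral Xs))"

lemma rep_product:
  "rep (foldr (clifford_mult \<epsilon>) (map clifford_vec vs) clifford_one) (u, w) =
    (if even (length vs) then (fst (chiral (map frame vs)) u, snd (chiral (map frame vs)) w)
     else (fst (chiral (map frame vs)) w, snd (chiral (map frame vs)) u))"
  by (induction vs) (simp_all add: rep_one rep_mult rep_vec_frame clifford_action_apply)

text \<open>Moving \<open>herm_op X\<close> across the form by self-adjointness produces minus the
  product of \<open>herm_op X\<close> and its adjugate, which is the scalar
  \<open>herm_form X\<close>; the two components then exchange roles, which the symmetry of the form
  permits. The resulting factor is the spinor norm.\<close>

lemma chiral_form: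
  "pair_form (fst (chiral Xs) u) (snd (chiral Xs) w) = prod_list (map herm_form Xs) * pair_form u w"
proof (induction Xs arbitrary: u w)
  case Nil
  then show ?case by simp
next
  case (Cons X Xs)
  have "pair_form (fst (chiral (X # Xs)) u) (snd (chiral (X # Xs)) w) =
      - pair_form (snd (chiral Xs) u) (herm_op X (herm_op (herm_adj X) (fst (chiral Xs) w)))"
    by (simp add: herm_op_self_adjoint linear_neg [OF herm_op_linear] pair_form_simps)
  also have "\<dots> = herm_form X * pair_form (fst (chiral Xs) w) (snd (chiral Xs) u)"
    by (simp add: herm_op_adj pair_form_simps pair_form_commute)
  finally show ?case by (simp add: Cons pair_form_commute)
qed

lemma chiral_det:
  assumes "\<forall>X\<in>set Xs. \<bar>herm_form X\<bar> = 1"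
  shows "SL2_det (prod_list (map (\<lambda>X. - herm_form X) Xs)) (fst (chiral Xs)) \<and>
    SL2_det (prod_list (map (\<lambda>X. - herm_form X) Xs)) (snd (chiral Xs))"
  using assms
proof (induction Xs)
  case Nil
  then show ?case using SL2_id by (simp add: SL2_det_def del: id_apply)
next
  case (Cons X Xs)
  then have "SL2_det (- herm_form X) (herm_op X)" "SL2_det (- herm_form X) (\<lambda>u. - herm_op (herm_adj X) u)"
    using herm_op_det [of X] SL2_det_uminus [OF herm_op_det [of "herm_adj X"]] by simp_all
  moreover have "SL2_det (prod_list (map (\<lambda>X. - herm_form X) Xs)) (fst (chiral Xs))"
    "SL2_det (prod_list (map (\<lambda>X. - herm_form X) Xs)) (snd (chiral Xs))"
    using Cons by simp_all
  ultimately show ?case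
    unfolding chiral.simps fst_conv snd_conv list.map prod_list.Cons by (intro conjI SL2_det_comp)
qed

text \<open>\<open>\<nu>\<close> is the spinor norm. The determinant sign from
  \<open>chiral_det\<close> is a product of factors \<open>- herm_form X\<close>, and an even number
  of them gives \<open>\<nu>\<close> itself, so \<open>\<nu> = 1\<close> puts the first component
  into \<open>SL2\<close>.\<close>

lemma Spin_full_chiral:
  assumes "g \<in> Spin_full \<epsilon>"
  obtains P M \<nu> where "\<nu> = 1 \<or> \<nu> = -1" "\<And>u w. rep g (u, w) = (P u, M w)"
    "\<And>u w. pair_form (P u) (M w) = \<nu> * pair_form u w" "\<nu> = 1 \<Longrightarrow> P \<in> SL2"
proof -
  obtain vs where vs: "g = foldr (clifford_mult \<epsilon>) (map clifford_vec vs) clifford_one"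
    "even (length vs)" "\<forall>v\<in>set vs. \<bar>diagonal_form \<epsilon> v\<bar> = 1"
    using assms unfolding Spin_full_def by blast
  let ?Xs = "map frame vs"
  let ?\<nu> = "prod_list (map herm_form ?Xs)"
  have unit: "\<forall>X\<in>set ?Xs. \<bar>herm_form X\<bar> = 1" using vs(3) by (simp add: herm_form_frame)
  have neg: "prod_list (map (\<lambda>X. - herm_form X) Xs) = (-1) ^ length Xs * prod_list (map herm_form Xs)" for Xs
    by (induction Xs) simp_all
  have abs: "\<bar>prod_list (map herm_form Xs)\<bar> = 1" if "\<forall>X\<in>set Xs. \<bar>herm_form X\<bar> = 1" for Xs
    using that by (induction Xs) (simp_all add: abs_mult)
  show ?thesis
  proof (rule that [of ?\<nu> "fst (chiral ?Xs)" "snd (chiral ?Xs)"])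
    show "?\<nu> = 1 \<or> ?\<nu> = -1" using abs [OF unit] by linarith
    show "rep g (u, w) = (fst (chiral ?Xs) u, snd (chiral ?Xs) w)" for u w
      using vs(2) by (simp add: vs(1) rep_product)
    show "pair_form (fst (chiral ?Xs) u) (snd (chiral ?Xs) w) = ?\<nu> * pair_form u w" for u w
      by (rule chiral_form)
    show "fst (chiral ?Xs) \<in> SL2" if "?\<nu> = 1"
      using chiral_det [OF unit] that vs(2) unfolding neg by (simp add: SL2_det_def)
  qed
qed

section \<open>The identity component of the spin group\<close>

definition Spin0 :: "(real ^ ('n set)) set" where
  "Spin0 = connected_component_set (Spin_full \<epsilon>) clifford_one"

lemma one_Spin_full: "clifford_one \<in> Spin_full \<epsilon>"
  unfolding Spin_full_def by (rule CollectI, rule exI [of _ "[]"]) simp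

lemma one_Spin0: "clifford_one \<in> Spin0"
  by (simp add: Spin0_def one_Spin_full)

lemma Spin0_Spin_full: "Spin0 \<subseteq> Spin_full \<epsilon>"
  by (simp add: Spin0_def connected_component_subset)

lemma Spin_full_mult:
  assumes "x \<in> Spin_full \<epsilon>" "y \<in> Spin_full \<epsilon>"
  shows "clifford_mult \<epsilon> x y \<in> Spin_full \<epsilon>"
proof -
  obtain vs ws where vs: "x = foldr (clifford_mult \<epsilon>) (map clifford_vec vs) clifford_one"
      "even (length vs)" "\<forall>v\<in>set vs. \<bar>diagonal_form \<epsilon> v\<bar> = 1"
    and ws: "y = foldr (clifford_mult \<epsilon>) (map clifford_vec ws) clifford_one"
      "even (length ws)" "\<forall>v\<in>set ws. \<bar>diagonal_form \<epsilon> v\<bar> = 1"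
    using assms unfolding Spin_full_def by blast
  have "clifford_mult \<epsilon> (foldr (clifford_mult \<epsilon>) (map clifford_vec vs) clifford_one) y =
      foldr (clifford_mult \<epsilon>) (map clifford_vec vs) y"
    by (induction vs) (simp_all add: clifford_mult_one clifford_mult_assoc)
  then have "clifford_mult \<epsilon> x y = foldr (clifford_mult \<epsilon>) (map clifford_vec (vs @ ws)) clifford_one"
    by (simp add: vs(1) ws(1))
  then show ?thesis
    using vs ws unfolding Spin_full_def by (intro CollectI exI [of _ "vs @ ws"]) auto
qed

text \<open>Left translation by \<open>x\<close> carries the identity component to a connected
  subset of \<open>Spin_full\<close> that contains \<open>x\<close>, hence stays in the same
  component.\<close>

lemma Spin0_mult:
  assumes "x \<in> Spin0" "y \<in> Spin0"
  shows "clifford_mult \<epsilon> x y \<in> Spin0"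
proof -
  have lin: "linear (clifford_mult \<epsilon> x)" using bilinear_clifford_mult [of \<epsilon>] by (simp add: bilinear_def)
  have "connected (clifford_mult \<epsilon> x ` Spin0)"
    unfolding Spin0_def
    by (intro connected_continuous_image linear_continuous_on connected_connected_component)
      (use lin in \<open>simp add: linear_conv_bounded_linear\<close>)
  moreover have "clifford_mult \<epsilon> x ` Spin0 \<subseteq> Spin_full \<epsilon>"
    using assms Spin0_Spin_full by (auto intro: Spin_full_mult)
  moreover have "x \<in> clifford_mult \<epsilon> x ` Spin0"
    using one_Spin0 clifford_mult_one(2) [of \<epsilon> x] by (metis imageI)
  ultimately have "connected_component (Spin_full \<epsilon>) x (clifford_mult \<epsilon> x y)"
    using assms(2) unfolding connected_component_def by blast
  then show ?thesis
    using assms(1) unfolding Spin0_def by (auto intro: connected_component_trans)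
qed

text \<open>The spinor norm \<open>\<nu>\<close> is continuous with values \<open>\<plusminus>1\<close>, hence constant on \<open>Spin0\<close>.\<close>

lemma Spin0_chiral:
  assumes "g \<in> Spin0"
  obtains P M where "\<And>u w. rep g (u, w) = (P u, M w)"
    "\<And>u w. pair_form (P u) (M w) = pair_form u w" "P \<in> SL2"
proof -
  \<comment> \<open>A vector with nonzero \<open>pair_form u0 u0\<close>: evaluating the form on it
    makes the spinor norm visible as the continuous function \<open>N\<close>, equal to
    \<open>2 * \<nu>\<close>.\<close>
  define u0 :: "'a ^ 2" where "u0 = pair_vec e 0"
  have u0: "pair_form u0 u0 = 2"
    by (simp add: u0_def pair_form_def polar_self [OF quadratic] Q_unit polar_simps)
  define N where "N x = pair_form (fst (rep x (u0, 0))) (snd (rep x (0, u0)))" for x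
  have N: "N x = 2 * \<nu>" if "\<And>u w. rep x (u, w) = (P u, M w)"
    "\<And>u w. pair_form (P u) (M w) = \<nu> * pair_form u w" for x P M \<nu>
    using that by (simp add: N_def u0)
  have "continuous_on S (\<lambda>x. rep x z)" for S z
    using linear_compose [OF linear_rep, of "\<lambda>T. blinfun_apply T z"]
    by (intro linear_continuous_on) (simp add: o_def linear_conv_bounded_linear [symmetric] linear_iff blinfun.add_left blinfun.scaleR_left)
  then have cont: "continuous_on S N" for S
    unfolding N_def
    by (intro bounded_bilinear.continuous_on [of pair_form] continuous_on_fst continuous_on_snd)
      (simp add: bilinear_pair_form flip: bilinear_conv_bounded_bilinear)
  have "N ` Spin0 \<subseteq> {2, -2}"
  proof
    fix r assume "r \<in> N ` Spin0"
    then obtain x where "x \<in> Spin_full \<epsilon>" "r = N x" using Spin0_Spin_full by auto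
    then obtain P M \<nu> where \<nu>: "\<nu> = 1 \<or> \<nu> = -1" and PM: "\<And>u w. rep x (u, w) = (P u, M w)"
      "\<And>u w. pair_form (P u) (M w) = \<nu> * pair_form u w"
      by (elim Spin_full_chiral) blast
    have "r = 2 * \<nu>" unfolding \<open>r = N x\<close> by (rule N [OF PM])
    with \<nu> show "r \<in> {2, -2}" by auto
  qed
  then have "finite (N ` Spin0)" by (rule finite_subset) simp
  moreover have "connected Spin0" by (simp add: Spin0_def)
  ultimately have "N constant_on Spin0"
    using continuous_finite_range_constant [of Spin0 N] cont by blast
  then have "N g = N clifford_one"
    using assms one_Spin0 unfolding constant_on_def by metis
  then have Ng: "N g = 2" by (simp add: N_def rep_one u0)
  have "g \<in> Spin_full \<epsilon>" using assms Spin0_Spin_full by blast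
  then obtain P M \<nu> where PM: "\<And>u w. rep g (u, w) = (P u, M w)"
    "\<And>u w. pair_form (P u) (M w) = \<nu> * pair_form u w" "\<nu> = 1 \<Longrightarrow> P \<in> SL2"
    by (rule Spin_full_chiral) blast
  have "\<nu> = 1" using N [OF PM(1,2)] Ng by simp
  with PM show ?thesis using that [of P M] by simp
qed

section \<open>The half-spin homomorphism onto SL_2\<close>

definition half_spin :: "real ^ ('n set) \<Rightarrow> ('a ^ 2) \<Rightarrow>\<^sub>L ('a ^ 2)" where
  "half_spin g = fst_blinfun o\<^sub>L rep g o\<^sub>L Blinfun (\<lambda>u. (u, 0))"

lemma linear_inl: "linear (\<lambda>u. (u :: 'a ^ 2, 0 :: 'a ^ 2))"
  and linear_inr: "linear (\<lambda>u. (0 :: 'a ^ 2, u :: 'a ^ 2))"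
  by (auto intro!: linearI)

lemma half_spin_apply: "half_spin g u = fst (rep g (u, 0))"
  by (simp add: half_spin_def bounded_linear_Blinfun_apply linear_inl linear_conv_bounded_linear [symmetric] fst_blinfun.rep_eq)

lemma linear_half_spin: "linear half_spin"
  by (rule linearI; rule blinfun_eqI)
    (simp_all add: half_spin_apply linear_add [OF linear_rep] linear_cmul [OF linear_rep]
      blinfun.add_left blinfun.scaleR_left)

lemma half_spin_Spin0: "g \<in> Spin0 \<Longrightarrow> blinfun_apply (half_spin g) \<in> SL2"
proof -
  assume "g \<in> Spin0"
  then obtain P M where "\<And>u w. rep g (u, w) = (P u, M w)" "P \<in> SL2"
    by (rule Spin0_chiral) blast
  moreover from this have "blinfun_apply (half_spin g) = P" by (simp add: fun_eq_iff half_spin_apply)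
  ultimately show ?thesis by simp
qed

text \<open>For \<open>h\<close> in \<open>Spin0\<close> the operator \<open>rep h\<close> is block
  diagonal, so it keeps the first summand and the upper left blocks multiply.\<close>

lemma half_spin_mult:
  assumes "h \<in> Spin0"
  shows "half_spin (clifford_mult \<epsilon> g h) = half_spin g o\<^sub>L half_spin h"
proof (rule blinfun_eqI)
  fix u
  obtain P M where PM: "\<And>u w. rep h (u, w) = (P u, M w)"
    using assms by (rule Spin0_chiral) blast
  have "M 0 = 0" using PM [of 0 0] by (simp flip: zero_prod_def add: blinfun.zero_right prod_eq_iff)
  then show "half_spin (clifford_mult \<epsilon> g h) u = (half_spin g o\<^sub>L half_spin h) u"
    by (simp add: half_spin_apply rep_mult PM)
qed

text \<open>The path \<open>\<tau> \<mapsto> (X + \<tau> Y) (\<eta> X)\<close> joins \<open>1\<close> to the required element.\<close>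

lemma Spin0_transvection:
  assumes "\<And>\<tau>. herm_form (X + \<tau> *\<^sub>R Y) = \<eta>" and \<eta>: "\<eta> = 1 \<or> \<eta> = -1"
  shows "\<exists>g\<in>Spin0. \<forall>u. half_spin g u = - \<eta> *\<^sub>R herm_op (X + Y) (herm_op (herm_adj X) u)"
proof -
  obtain v w where v: "frame v = X" and w: "frame w = Y"
    using frame_surj unfolding frame_def by metis
  have frame: "frame (v + \<tau> *\<^sub>R w) = X + \<tau> *\<^sub>R Y" "frame (\<eta> *\<^sub>R v) = \<eta> *\<^sub>R X" for \<tau>
    by (simp_all add: linear_add [OF linear_frame] linear_cmul [OF linear_frame] v w)
  define g where "g \<tau> = clifford_mult \<epsilon> (clifford_vec (v + \<tau> *\<^sub>R w)) (clifford_vec (\<eta> *\<^sub>R v))" for \<tau>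
  have form: "diagonal_form \<epsilon> (v + \<tau> *\<^sub>R w) = \<eta>" for \<tau>
    using assms(1) [of \<tau>] frame(1) [of \<tau>] herm_form_frame [of "v + \<tau> *\<^sub>R w"] by simp
  have form_v: "diagonal_form \<epsilon> v = \<eta>" using form [of 0] by simp
  then have form_v': "diagonal_form \<epsilon> (\<eta> *\<^sub>R v) = \<eta>"
    using \<eta> by (auto simp: diagonal_form_def)
  have vec: "clifford_vec (x + y) = clifford_vec x + clifford_vec y"
    "clifford_vec (r *\<^sub>R x) = r *\<^sub>R clifford_vec x" for x y :: "(real, 'n) vec" and r
    by (simp_all add: clifford_vec_def vec_eq_iff axis_def sum.distrib [symmetric] sum_distrib_left)
      (auto intro!: sum.cong)
  have "g \<tau> = foldr (clifford_mult \<epsilon>) (map clifford_vec [v + \<tau> *\<^sub>R w, \<eta> *\<^sub>R v]) clifford_one" for \<tau>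
    by (simp add: g_def clifford_mult_one)
  moreover have "\<forall>x\<in>set [v + \<tau> *\<^sub>R w, \<eta> *\<^sub>R v]. \<bar>diagonal_form \<epsilon> x\<bar> = 1" for \<tau>
    using form [of \<tau>] form_v' \<eta> by auto
  ultimately have "g \<tau> \<in> Spin_full \<epsilon>" for \<tau>
    unfolding Spin_full_def by (intro CollectI exI [of _ "[v + \<tau> *\<^sub>R w, \<eta> *\<^sub>R v]"]) simp
  then have full: "range g \<subseteq> Spin_full \<epsilon>" by auto
  have g_affine: "g \<tau> = g 0 + \<tau> *\<^sub>R clifford_mult \<epsilon> (clifford_vec w) (clifford_vec (\<eta> *\<^sub>R v))" for \<tau>
    by (simp add: g_def vec bilinear_ladd [OF bilinear_clifford_mult] bilinear_lmul [OF bilinear_clifford_mult])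
  have "continuous_on UNIV g"
    by (subst g_affine [abs_def]) (intro continuous_intros)
  then have "connected (range g)" by (rule connected_continuous_image) (rule connected_UNIV)
  \<comment> \<open>By \<open>clifford_vec_square\<close> the path starts at the scalar
    \<open>\<eta> * \<eta> = 1\<close>.\<close>
  moreover have "g 0 = clifford_one"
    using \<eta> by (auto simp: g_def vec clifford_vec_square form_v bilinear_rmul [OF bilinear_clifford_mult]
        bilinear_rneg [OF bilinear_clifford_mult])
  ultimately have "g 1 \<in> Spin0"
    using full unfolding Spin0_def by (auto simp: connected_component_def intro!: exI [of _ "range g"]) (metis rangeI)
  moreover have "half_spin (g 1) u = - \<eta> *\<^sub>R herm_op (X + Y) (herm_op (herm_adj X) u)" for u
  proof -
    have "herm_adj (\<eta> *\<^sub>R X) = \<eta> *\<^sub>R herm_adj X" by (cases X) (simp add: herm_adj_def)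
    then show ?thesis
      using frame(1) [of 1]
      by (simp add: g_def half_spin_apply rep_mult rep_vec_frame frame clifford_action_apply herm_op_scale
          linear_neg [OF herm_op_linear] linear_cmul [OF herm_op_linear])
  qed
  ultimately show ?thesis by blast
qed

text \<open>After scaling \<open>a\<close> to \<open>x\<close> with \<open>Q x = \<eta>\<close>, the
  matrix with off-diagonal part \<open>x\<close> or \<open>conjg x\<close> is moved along an
  isotropic diagonal matrix orthogonal to it; the form stays constant, and the product from
  \<open>Spin0_transvection\<close> works out to the elementary matrix.\<close>

lemma upper_lower_lift_nonnull:
  assumes "Q a \<noteq> 0"
  shows "\<exists>g\<in>Spin0. blinfun_apply (half_spin g) = upper a" "\<exists>g\<in>Spin0. blinfun_apply (half_spin g) = lower a"
proof -
  define \<eta> where "\<eta> = sgn (Q a)"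
  define r where "r = sqrt \<bar>Q a\<bar>"
  have \<eta>: "\<eta> = 1 \<or> \<eta> = -1" using assms by (auto simp: \<eta>_def sgn_if)
  then have \<eta>\<eta>: "\<eta> * \<eta> = 1" by auto
  have r: "r \<noteq> 0" using assms by (simp add: r_def)
  define x where "x = (1 / r) *\<^sub>R a"
  have Qx: "Q x = \<eta>" "Q (conjg x) = \<eta>"
    using assms by (simp_all add: x_def Q_scale r_def \<eta>_def power_divide sgn_if)
  have a: "a = r *\<^sub>R x" using r by (simp add: x_def)
  obtain g where g: "g \<in> Spin0"
    "\<And>u. half_spin g u = - \<eta> *\<^sub>R herm_op ((0, x, 0) + (\<eta> * r, 0, 0)) (herm_op (herm_adj (0, x, 0)) u)"
    using Spin0_transvection [of "(0, x, 0)" "(\<eta> * r, 0, 0)" \<eta>] \<eta> by (auto simp: herm_form_def Qx)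
  have "half_spin g u = upper a u" for u
    using mult_conjg_cancel [of x "u $ 1"] conjg_mult_cancel [of x "u $ 2"]
    by (simp add: g(2) herm_op_def herm_adj_def upper_def pair_vec_eq_iff mult_simps conjg_simps Qx
        a \<eta>\<eta> scaleR_right_diff_distrib scaleR_right_distrib flip: mult.assoc)
  then show "\<exists>g\<in>Spin0. blinfun_apply (half_spin g) = upper a" using g(1) by blast
  obtain g where g: "g \<in> Spin0"
    "\<And>u. half_spin g u = - \<eta> *\<^sub>R herm_op ((0, conjg x, 0) + (0, 0, \<eta> * r)) (herm_op (herm_adj (0, conjg x, 0)) u)"
    using Spin0_transvection [of "(0, conjg x, 0)" "(0, 0, \<eta> * r)" \<eta>] \<eta> by (auto simp: herm_form_def Qx)
  have "half_spin g u = lower a u" for u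
    using mult_conjg_cancel [of "conjg x" "u $ 1"] conjg_mult_cancel [of "conjg x" "u $ 2"]
    by (simp add: g(2) herm_op_def herm_adj_def lower_def pair_vec_eq_iff mult_simps conjg_simps Qx
        a \<eta>\<eta> scaleR_right_diff_distrib scaleR_right_distrib flip: mult.assoc)
  then show "\<exists>g\<in>Spin0. blinfun_apply (half_spin g) = lower a" using g(1) by blast
qed

text \<open>Subtracting a large real multiple of the unit: \<open>Q (a - r *\<^sub>R e)\<close> is
  quadratic in \<open>r\<close> with leading coefficient \<open>Q e = 1\<close>, and the chosen
  \<open>r\<close> dominates the other coefficients.\<close>

lemma nonnull_decomposition:
  obtains b c where "a = b + c" "Q b \<noteq> 0" "Q c \<noteq> 0"
proof -
  define r where "r = \<bar>Q a\<bar> + \<bar>polar Q a e\<bar> + 1"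
  have r: "r \<ge> 1" by (simp add: r_def)
  have "r * \<bar>Q a\<bar> \<ge> \<bar>Q a\<bar>" using mult_right_mono [OF r, of "\<bar>Q a\<bar>"] by simp
  moreover have "r * polar Q a e \<le> r * \<bar>polar Q a e\<bar>" using r by (intro mult_left_mono) auto
  moreover have "r * r = r * \<bar>Q a\<bar> + r * \<bar>polar Q a e\<bar> + r"
    by (subst (2) r_def) (simp add: algebra_simps)
  ultimately have "Q a + r * r - r * polar Q a e > 0" using r by linarith
  then have "Q (a - r *\<^sub>R e) \<noteq> 0"
    by (simp add: Q_diff Q_scale Q_unit polar_simps power2_eq_square)
  moreover have "Q (r *\<^sub>R e) \<noteq> 0" using r by (simp add: Q_scale Q_unit)
  ultimately show ?thesis using that [of "a - r *\<^sub>R e" "r *\<^sub>R e"] by simp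
qed

lemma lift_comp:
  assumes "\<exists>g\<in>Spin0. blinfun_apply (half_spin g) = F" "\<exists>g\<in>Spin0. blinfun_apply (half_spin g) = G"
  shows "\<exists>g\<in>Spin0. blinfun_apply (half_spin g) = F \<circ> G"
proof -
  obtain g h where "g \<in> Spin0" "h \<in> Spin0" "blinfun_apply (half_spin g) = F" "blinfun_apply (half_spin h) = G"
    using assms by blast
  then have "clifford_mult \<epsilon> g h \<in> Spin0" "blinfun_apply (half_spin (clifford_mult \<epsilon> g h)) = F \<circ> G"
    by (auto simp: Spin0_mult half_spin_mult)
  then show ?thesis by blast
qed

lemma half_spin_surj: "F \<in> SL2 \<Longrightarrow> \<exists>g\<in>Spin0. blinfun_apply (half_spin g) = F"
proof (induction rule: SL2_induct)
  case id
  have "blinfun_apply (half_spin clifford_one) = id" by (simp add: fun_eq_iff half_spin_apply rep_one)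
  then show ?case using one_Spin0 by blast
next
  case (upper a)
  obtain b c where "a = b + c" "Q b \<noteq> 0" "Q c \<noteq> 0" by (rule nonnull_decomposition)
  then show ?case
    using lift_comp upper_lower_lift_nonnull(1) upper_upper [of b c] by metis
next
  case (lower a)
  obtain b c where "a = b + c" "Q b \<noteq> 0" "Q c \<noteq> 0" by (rule nonnull_decomposition)
  then show ?case
    using lift_comp upper_lower_lift_nonnull(2) lower_lower [of b c] by metis
next
  case (comp F G)
  then show ?case by (intro lift_comp)
qed

text \<open>On \<open>Spin0\<close> the other half-spin action is the inverse adjoint of \<open>half_spin\<close> with respect to
  \<open>pair_form\<close>, and the Clifford element is recovered linearly from both by \<open>rep_coefficient\<close>.\<close>

lemma half_spin_smooth_left_inverse:
  obtains H :: "(('a ^ 2) \<Rightarrow>\<^sub>L ('a ^ 2)) \<Rightarrow> real ^ ('n set)"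
  where "\<And>g. g \<in> Spin0 \<Longrightarrow> H (half_spin g) = g" "\<And>g. g \<in> Spin0 \<Longrightarrow> half_spin g \<in> blinfun_units"
    "\<And>k. Ck_on k H blinfun_units"
proof -
  obtain R where R: "linear R" "\<And>T u w. pair_form (blinfun_apply T u) w = pair_form u (blinfun_apply (R T) w)"
    by (rule pair_form_adjoint) blast
  define D1 :: "(('a ^ 2) \<Rightarrow>\<^sub>L ('a ^ 2)) \<Rightarrow> (('a ^ 2) \<times> ('a ^ 2)) \<Rightarrow>\<^sub>L (('a ^ 2) \<times> ('a ^ 2))" where "D1 T = Blinfun (\<lambda>u. (u :: 'a ^ 2, 0 :: 'a ^ 2)) o\<^sub>L (T o\<^sub>L fst_blinfun)" for T
  define D2 :: "(('a ^ 2) \<Rightarrow>\<^sub>L ('a ^ 2)) \<Rightarrow> (('a ^ 2) \<times> ('a ^ 2)) \<Rightarrow>\<^sub>L (('a ^ 2) \<times> ('a ^ 2))" where "D2 T = Blinfun (\<lambda>u. (0 :: 'a ^ 2, u :: 'a ^ 2)) o\<^sub>L (T o\<^sub>L snd_blinfun)" for T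
  \<comment> \<open>The trace formula of \<open>rep_coefficient\<close>, extended to all operators
    so that it is linear and can be applied to the diagonal blocks \<open>D1\<close> and
    \<open>D2\<close> separately.\<close>
  define C where "C T = (\<chi> A. blinfun_trace (rep_basis A o\<^sub>L T) / (clifford_sign \<epsilon> A A * DIM(('a ^ 2) \<times> ('a ^ 2))))" for T
  have C: "C (rep x) = x" for x
    unfolding C_def by (simp only: rep_coefficient [symmetric] vec_nth_inverse)
  have linC: "linear C"
    unfolding C_def
    by (rule linearI) (simp_all add: vec_eq_iff blinfun_compose.add_right blinfun_compose.scaleR_right
        linear_add [OF linear_blinfun_trace] linear_cmul [OF linear_blinfun_trace] add_divide_distrib)
  have linD: "linear D1" "linear D2"
    unfolding D1_def D2_def
    by (auto intro!: linearI simp: blinfun_compose.add_right blinfun_compose.scaleR_right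
        blinfun_compose.add_left blinfun_compose.scaleR_left)
  have D_apply: "(D1 S + D2 T) (u, w) = (S u, T w)" for S T u w
    using linear_inl linear_inr
    by (simp add: D1_def D2_def blinfun.add_left bounded_linear_Blinfun_apply linear_conv_bounded_linear
        fst_blinfun.rep_eq snd_blinfun.rep_eq)
  define H where "H A = C (D1 A) + C (D2 (R (blinfun_inverse A)))" for A
  have inv: "half_spin g \<in> blinfun_units \<and> H (half_spin g) = g" if "g \<in> Spin0" for g
  proof -
    obtain P M where PM: "\<And>u w. rep g (u, w) = (P u, M w)" "\<And>u w. pair_form (P u) (M w) = pair_form u w"
      using \<open>g \<in> Spin0\<close> by (rule Spin0_chiral) blast
    define A where "A = half_spin g"
    have A: "blinfun_apply A = P" by (simp add: A_def fun_eq_iff half_spin_apply PM)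
    have unit: "A \<in> blinfun_units"
    proof (rule blinfun_units_injectiveI)
      fix u
      assume "A u = 0"
      then have "pair_form w u = 0" for w using PM(2) [of u w] by (simp add: A pair_form_simps pair_form_commute bilinear_lzero [OF bilinear_pair_form])
      then show "u = 0" by (intro pair_form_eqI) (simp add: bilinear_rzero [OF bilinear_pair_form])
    qed
    define B where "B = blinfun_inverse A"
    have "A o\<^sub>L B = id_blinfun" using blinfun_inverse_works(1) [OF unit] by (simp add: B_def)
    then have AB: "P (B v) = v" for v
      by (metis A blinfun_apply_blinfun_compose blinfun_apply_id_blinfun)
    \<comment> \<open>Putting \<open>B v\<close> into the invariance of \<open>pair_form\<close>
      identifies \<open>M\<close> as the adjoint of the inverse of \<open>P\<close>.\<close>
    have "M w = R B w" for w
    proof (rule pair_form_eqI)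
      fix v
      show "pair_form v (M w) = pair_form v (R B w)"
        using PM(2) [of "B v" w] by (simp add: AB R(2))
    qed
    then have "rep g = D1 A + D2 (R B)"
      by (intro blinfun_eqI) (auto simp: PM D_apply A)
    then have "H A = C (rep g)"
      by (simp add: H_def B_def linear_add [OF linC])
    then show ?thesis using unit by (simp add: A_def C)
  qed
  have "Ck_on k H blinfun_units" for k
  proof -
    have "bounded_linear (\<lambda>A. C (D1 A))" "bounded_linear (\<lambda>T. C (D2 (R T)))"
      using linear_compose [OF linD(1) linC] linear_compose [OF linear_compose [OF R(1) linD(2)] linC]
      by (auto intro!: linear_blinfun_bounded simp: o_def)
    then show ?thesis
      unfolding H_def
      by (intro Ck_on_add open_blinfun_units bounded_linear_Ck_on
          Ck_on_bounded_linear [of "\<lambda>T. C (D2 (R T))"] Ck_on_blinfun_inverse)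
  qed
  with inv show ?thesis using that [of H] by blast
qed

text \<open>The isomorphism is the left inverse \<open>H\<close> of \<open>half_spin\<close>, smooth
  on the open set of invertible operators. Its own inverse is \<open>half_spin\<close>, which is
  smooth as the restriction of a linear map.\<close>

lemma SL2_Spin0_isomorphic:
  "lie_group_isomorphic (linear_group (SL cmul e :: ('a ^ 2 \<Rightarrow> 'a ^ 2) monoid))
    \<lparr>carrier = Spin0, mult = clifford_mult \<epsilon>, one = clifford_one\<rparr>"
    (is "lie_group_isomorphic ?G ?H")
proof -
  obtain H :: "(('a ^ 2) \<Rightarrow>\<^sub>L ('a ^ 2)) \<Rightarrow> real ^ ('n set)"
    where H: "\<And>g. g \<in> Spin0 \<Longrightarrow> H (half_spin g) = g" "\<And>g. g \<in> Spin0 \<Longrightarrow> half_spin g \<in> blinfun_units"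
      "\<And>k. Ck_on k H blinfun_units"
    by (rule half_spin_smooth_left_inverse) blast
  have carrier: "carrier ?G = half_spin ` Spin0"
  proof -
    have "Blinfun F \<in> half_spin ` Spin0" if "F \<in> SL2" for F
      using half_spin_surj [OF that] by (metis blinfun_apply_inverse imageI)
    moreover have "half_spin g \<in> Blinfun ` SL2" if "g \<in> Spin0" for g
      using half_spin_Spin0 [OF that] by (metis blinfun_apply_inverse imageI)
    ultimately show ?thesis by (auto simp: linear_group_def)
  qed
  have inj: "inj_on H (carrier ?G)"
    unfolding carrier by (rule inj_on_inverseI [where g = half_spin]) (auto simp: H(1))
  have "H \<in> iso ?G ?H"
    unfolding iso_def hom_def
  proof (intro CollectI conjI ballI funcsetI)
    show "H x \<in> carrier ?H" if "x \<in> carrier ?G" for x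
      using that by (auto simp: carrier H(1))
    show "bij_betw H (carrier ?G) (carrier ?H)"
      using inj by (auto simp: bij_betw_def carrier H(1) image_image)
    fix x y
    assume "x \<in> carrier ?G" "y \<in> carrier ?G"
    then obtain g h where "g \<in> Spin0" "h \<in> Spin0" "x = half_spin g" "y = half_spin h"
      by (auto simp: carrier)
    then show "H (x \<otimes>\<^bsub>?G\<^esub> y) = H x \<otimes>\<^bsub>?H\<^esub> H y"
      using H(1) [OF Spin0_mult [of g h]] by (simp add: linear_group_def half_spin_mult H(1))
  qed
  moreover have "smooth_map_on (carrier ?G) H"
    unfolding smooth_map_on_def
    using H(2,3) open_blinfun_units by (intro ballI exI [of _ blinfun_units] exI [of _ H]) (auto simp: carrier)
  moreover have "smooth_map_on (carrier ?H) (inv_into (carrier ?G) H)"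
  proof -
    have "inv_into (carrier ?G) H g = half_spin g" if "g \<in> Spin0" for g
      using inj that by (intro inv_into_f_eq) (auto simp: carrier H(1))
    moreover have "Ck_on k half_spin UNIV" for k
      using linear_half_spin by (intro bounded_linear_Ck_on) (simp_all add: linear_conv_bounded_linear)
    ultimately show ?thesis
      unfolding smooth_map_on_def by (intro ballI exI [of _ UNIV] exI [of _ half_spin]) auto
  qed
  ultimately show ?thesis unfolding lie_group_isomorphic_def by blast
qed

end

theorem theorem3p5:
  fixes cmul :: "'a::euclidean_space \<Rightarrow> 'a \<Rightarrow> 'a" and e :: 'a and Q :: "'a \<Rightarrow> real"
    and d p q :: nat
  assumes "unital_real_composition_algebra cmul e Q"
    and "DIM('a) = d"
    and "has_signature Q p q"
    and "CARD('n::{finite,linorder}) = p + q + 2"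
  shows "lie_group_isomorphic
           (linear_group (SL cmul e :: ('a ^ 2 \<Rightarrow> 'a ^ 2) monoid))
           (Spin (p + 1) (q + 1) :: (real ^ ('n set)) monoid)"
proof -
  interpret composition_algebra cmul e Q
    by unfold_locales (rule assms(1))
  obtain f :: "'n \<Rightarrow> real \<times> 'a \<times> real"
    where f: "\<And>v. herm_form (\<Sum>i\<in>UNIV. v $ i *\<^sub>R f i) = diagonal_form (standard_sign (p + 1) (q + 1)) v"
      "\<And>X. \<exists>v. (\<Sum>i\<in>UNIV. v $ i *\<^sub>R f i) = X"
    using hermitian_frame_exists [OF assms(3,4)] by blast
  \<comment> \<open>Since ranks stay below the cardinality, every sign is 1 or -1, as the locale
    requires.\<close>
  have "card {j. j < i} < CARD('n)" for i :: 'n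
    by (intro psubset_card_mono) auto
  then have "standard_sign (p + 1) (q + 1) i \<noteq> 0" for i :: 'n
    by (simp add: standard_sign_def assms(4))
  then interpret hermitian_frame cmul e Q "standard_sign (p + 1) (q + 1)" f
    using f by unfold_locales auto
  show ?thesis
    using SL2_Spin0_isomorphic unfolding Spin_def Spin0_def .
qed

end
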